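(* Let $\ell \geq 1$ be an integer, let $G$ be a graph on $n$ vertices, let $(L,H,R)$ be an excellent partition of $V(G)$, and let $(I,O)$ be a partition of $H \cup R$. If at least $\frac{|L|}{10}$ vertices in $R$ have degree less than $10\ell$ in $G$, then there are at most $2^{|L|}\cdot e^{-\frac{|L|}{2^{10\ell}\cdot 100\ell^2}}$ minimal $(I,O)$-extensions. Further, the family of all minimal $(I,O)$-extensions can be enumerated in time $2^{|L|}\cdot e^{-\frac{|L|}{2^{10\ell}\cdot 100\ell^2}}\cdot n^{\mathcal{O}(1)}$.
   Context: All graphs are finite and simple. For the fixed integer $\ell$, a partition $(L,H,R)$ of $V(G)$ is a good partition if $|L| \geq 10|H|$, $L$ is an independent set, and every vertex of $L$ has fewer than $\ell$ neighbors in $R$; it is an excellent partition if moreover $G[H \cup R]$ has no edges. A vertex set $X$ is a connected dominating set of $G$ if every vertex not in $X$ has a neighbor in $X$ and $G[X]$ is connected. For disjoint vertex sets $I$ and $O$, an $(I,O)$-extension is a vertex set $S$ disjoint from $I \cup O$ such that $I \cup S$ is a connected dominating set of $G$; it is minimal if no proper subset of it is also an $(I,O)$-extension. *)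

theory Defs
  imports Complex_Main "Graph_Theory.Pair_Digraph" "Graph_Theory.Digraph_Component"
begin

text \<open>A finite simple graph is a \<open>pair_graph\<close>: every edge \<open>{u,v}\<close> is present as the two
  arcs \<open>(u,v)\<close> and \<open>(v,u)\<close>, so that the out-degree is the degree.\<close>

definition nbrs :: "'a pair_pre_digraph \<Rightarrow> 'a \<Rightarrow> 'a set" where
  "nbrs G v = {u. (v, u) \<in> parcs G}"

definition independent :: "'a pair_pre_digraph \<Rightarrow> 'a set \<Rightarrow> bool" where
  "independent G X \<longleftrightarrow> (\<forall>u\<in>X. \<forall>v\<in>X. (u, v) \<notin> parcs G)"

text \<open>Partitions are ordered, and their parts may be empty.\<close>

definition partition3 :: "'a set \<Rightarrow> 'a set \<Rightarrow> 'a set \<Rightarrow> 'a set \<Rightarrow> bool" where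
  "partition3 X A B C \<longleftrightarrow> A \<union> B \<union> C = X \<and> A \<inter> B = {} \<and> A \<inter> C = {} \<and> B \<inter> C = {}"

definition partition2 :: "'a set \<Rightarrow> 'a set \<Rightarrow> 'a set \<Rightarrow> bool" where
  "partition2 X A B \<longleftrightarrow> A \<union> B = X \<and> A \<inter> B = {}"

definition good_partition ::
    "nat \<Rightarrow> 'a pair_pre_digraph \<Rightarrow> 'a set \<Rightarrow> 'a set \<Rightarrow> 'a set \<Rightarrow> bool" where
  "good_partition l G L H R \<longleftrightarrow>
     partition3 (pverts G) L H R \<and> card L \<ge> 10 * card H \<and> independent G L \<and>
     (\<forall>v\<in>L. card (nbrs G v \<inter> R) < l)"

definition excellent_partition ::
    "nat \<Rightarrow> 'a pair_pre_digraph \<Rightarrow> 'a set \<Rightarrow> 'a set \<Rightarrow> 'a set \<Rightarrow> bool" where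
  "excellent_partition l G L H R \<longleftrightarrow>
     good_partition l G L H R \<and> arcs (with_proj G \<restriction> (H \<union> R)) = {}"

definition connected_dominating_set :: "'a pair_pre_digraph \<Rightarrow> 'a set \<Rightarrow> bool" where
  "connected_dominating_set G X \<longleftrightarrow>
     X \<subseteq> pverts G \<and> (\<forall>v \<in> pverts G - X. \<exists>u\<in>X. u \<in> nbrs G v) \<and>
     Digraph_Component.connected (with_proj G \<restriction> X)"

definition extension :: "'a pair_pre_digraph \<Rightarrow> 'a set \<Rightarrow> 'a set \<Rightarrow> 'a set \<Rightarrow> bool" where
  "extension G I O' S \<longleftrightarrow>
     S \<subseteq> pverts G \<and> S \<inter> (I \<union> O') = {} \<and> connected_dominating_set G (I \<union> S)"

definition minimal_extension :: "'a pair_pre_digraph \<Rightarrow> 'a set \<Rightarrow> 'a set \<Rightarrow> 'a set \<Rightarrow> bool" where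
  "minimal_extension G I O' S \<longleftrightarrow>
     extension G I O' S \<and> (\<forall>T. T \<subset> S \<longrightarrow> \<not> extension G I O' T)"

text \<open>The model of computation is a first-order functional language over binary trees with
  unit-cost operations. A program is a list of function bodies; in a body, \<open>Var i\<close> is the
  \<open>i\<close>-th argument. There are no primitives on trees beyond allocating a cell, following a
  pointer and testing for \<open>Null\<close>, so each evaluation step is a constant number of operations
  of a random access machine. Conversely, a random access machine running for \<open>T\<close> steps on
  words of \<open>w\<close> bits is simulated with overhead polynomial in \<open>w + log T\<close>, by keeping its
  memory in a balanced tree. Hence bounds of the form \<open>f \<cdot> n\<^sup>O\<^sup>(\<^sup>1\<^sup>)\<close> with \<open>f \<le> 2\<^sup>n\<close>
  do not depend on the choice between the two models.\<close>

datatype data = Null | Cell data data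

datatype expr =
    Var nat
  | ENull
  | ECell expr expr
  | Fst expr
  | Snd expr
  | IfCell expr expr expr
  | Call nat "expr list"

type_synonym program = "expr list"

fun left_part :: "data \<Rightarrow> data" where
  "left_part Null = Null"
| "left_part (Cell x y) = x"

fun right_part :: "data \<Rightarrow> data" where
  "right_part Null = Null"
| "right_part (Cell x y) = y"

text \<open>\<open>eval p env e v t\<close>: in program \<open>p\<close>, with arguments \<open>env\<close>, the expression \<open>e\<close> evaluates
  to \<open>v\<close> in \<open>t\<close> steps.\<close>

inductive eval :: "program \<Rightarrow> data list \<Rightarrow> expr \<Rightarrow> data \<Rightarrow> nat \<Rightarrow> bool"
  and evals :: "program \<Rightarrow> data list \<Rightarrow> expr list \<Rightarrow> data list \<Rightarrow> nat \<Rightarrow> bool"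
  for p :: program
where
  eval_Var: "i < length env \<Longrightarrow> eval p env (Var i) (env ! i) 1"
| eval_Null: "eval p env ENull Null 1"
| eval_Cell: "eval p env a x s \<Longrightarrow> eval p env b y t \<Longrightarrow>
    eval p env (ECell a b) (Cell x y) (s + t + 1)"
| eval_Fst: "eval p env a x t \<Longrightarrow> eval p env (Fst a) (left_part x) (t + 1)"
| eval_Snd: "eval p env a x t \<Longrightarrow> eval p env (Snd a) (right_part x) (t + 1)"
| eval_If_Cell: "eval p env c (Cell x y) s \<Longrightarrow> eval p env a v t \<Longrightarrow>
    eval p env (IfCell c a b) v (s + t + 1)"
| eval_If_Null: "eval p env c Null s \<Longrightarrow> eval p env b v t \<Longrightarrow>
    eval p env (IfCell c a b) v (s + t + 1)"
| eval_Call: "f < length p \<Longrightarrow> evals p env es vs s \<Longrightarrow> eval p vs (p ! f) v t \<Longrightarrow>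
    eval p env (Call f es) v (s + t + 1)"
| evals_Nil: "evals p env [] [] 0"
| evals_Cons: "eval p env e v s \<Longrightarrow> evals p env es vs t \<Longrightarrow>
    evals p env (e # es) (v # vs) (s + t)"

inductive_cases eval_VarE: "eval p env (Var i) v t"
inductive_cases eval_NullE: "eval p env ENull v t"
inductive_cases eval_CellE: "eval p env (ECell a b) v t"
inductive_cases eval_FstE: "eval p env (Fst a) v t"
inductive_cases eval_SndE: "eval p env (Snd a) v t"
inductive_cases eval_IfE: "eval p env (IfCell c a b) v t"
inductive_cases eval_CallE: "eval p env (Call f es) v t"
inductive_cases evals_NilE: "evals p env [] vs t"
inductive_cases evals_ConsE: "evals p env (e # es) vs t"

lemma eval_deterministic:
  "eval p env e v t \<Longrightarrow> eval p env e v' t' \<Longrightarrow> v' = v \<and> t' = t"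
  "evals p env es vs s \<Longrightarrow> evals p env es vs' s' \<Longrightarrow> vs' = vs \<and> s' = s"
proof (induction arbitrary: v' t' and vs' s' rule: eval_evals.inducts)
  case (eval_Var i env) from eval_Var.prems show ?case by (rule eval_VarE) simp
next
  case (eval_Null env) from eval_Null.prems show ?case by (rule eval_NullE) simp
next
  case (eval_Cell env a x s b y t)
  from eval_Cell.prems show ?case by (rule eval_CellE) (auto dest!: eval_Cell.IH(2,4))
next
  case (eval_Fst env a x t)
  from eval_Fst.prems show ?case by (rule eval_FstE) (auto dest!: eval_Fst.IH(2))
next
  case (eval_Snd env a x t)
  from eval_Snd.prems show ?case by (rule eval_SndE) (auto dest!: eval_Snd.IH(2))
next
  case (eval_If_Cell env c x y s a v t b)
  from eval_If_Cell.prems show ?case by (rule eval_IfE) (auto dest!: eval_If_Cell.IH(2,4))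
next
  case (eval_If_Null env c s b v t a)
  from eval_If_Null.prems show ?case by (rule eval_IfE) (auto dest!: eval_If_Null.IH(2,4))
next
  case (eval_Call f env es vs s v t)
  from eval_Call.prems show ?case
  proof (rule eval_CallE)
    fix ws s1 t1
    assume t': "t' = Suc (s1 + t1)" and es: "evals p env es ws s1" and e: "eval p ws (p ! f) v' t1"
    from es have "ws = vs \<and> s1 = s" by (rule eval_Call.IH(3))
    moreover from this e have "v' = v \<and> t1 = t" by (intro eval_Call.IH(5)) simp
    ultimately show ?thesis using t' by simp
  qed
next
  case (evals_Nil env) from evals_Nil.prems show ?case by (rule evals_NilE) simp
next
  case (evals_Cons env e v s es vs t)
  from evals_Cons.prems show ?case by (rule evals_ConsE) (auto dest!: evals_Cons.IH(2,4))
qed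

definition runs :: "program \<Rightarrow> data \<Rightarrow> data \<Rightarrow> nat \<Rightarrow> bool" where
  "runs p x y t \<longleftrightarrow> p \<noteq> [] \<and> eval p [x] (p ! 0) y t"

fun enc_list :: "('a \<Rightarrow> data) \<Rightarrow> 'a list \<Rightarrow> data" where
  "enc_list f [] = Null"
| "enc_list f (x # xs) = Cell (f x) (enc_list f xs)"

text \<open>Numbers are encoded in unary; for vertices \<open>v < n\<close> this costs a factor of at most \<open>n\<close>.\<close>

fun enc_nat :: "nat \<Rightarrow> data" where
  "enc_nat 0 = Null"
| "enc_nat (Suc k) = Cell Null (enc_nat k)"

definition enc_set :: "nat set \<Rightarrow> data" where
  "enc_set X = enc_list enc_nat (sorted_list_of_set X)"

text \<open>Adjacency lists of a graph with vertex set \<open>{..<n}\<close>.\<close>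

definition enc_graph :: "nat pair_pre_digraph \<Rightarrow> data" where
  "enc_graph G = enc_list (\<lambda>v. enc_set (nbrs G v)) [0..<card (pverts G)]"

definition enc_input :: "nat \<Rightarrow> nat pair_pre_digraph \<Rightarrow>
    nat set \<Rightarrow> nat set \<Rightarrow> nat set \<Rightarrow> nat set \<Rightarrow> nat set \<Rightarrow> data" where
  "enc_input l G L H R I O' =
     Cell (enc_nat l) (Cell (enc_graph G)
       (Cell (enc_set L) (Cell (enc_set H) (Cell (enc_set R) (Cell (enc_set I) (enc_set O'))))))"

end

theory Submission
  imports Defs
begin

text \<open>
  A vertex \<open>v\<close> of \<open>R\<close> has all its neighbours in \<open>L\<close>. If the empty set is not an extension, every
  extension \<open>S\<close> meets the neighbourhood of \<open>v\<close>: to dominate \<open>v\<close> if \<open>v \<in> O'\<close>, to connect \<open>v\<close> to the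
  rest if \<open>v \<in> I\<close>. Among the vertices of \<open>R\<close> of degree less than \<open>10 l\<close>, a maximal family with
  pairwise disjoint neighbourhoods has at least \<open>|L| / (100 l\<^sup>2)\<close> members, and each of them excludes
  a fraction of at least \<open>2\<^sup>-\<^sup>1\<^sup>0\<^sup>l\<close> of the subsets of \<open>L\<close>, independently of the others.

  A connected dominating set remains one when vertices are added. So minimality can be tested by
  removing single vertices, and a branching algorithm that decides the vertices of \<open>L\<close> one after the
  other can discard a partial choice as soon as taking all undecided vertices does not give an
  extension. Every leaf of the pruned tree is then an extension, and the bound on the number of all
  extensions bounds the running time.
\<close>

section \<open>Counting extensions\<close>

text \<open>A random subset of \<open>L\<close> misses \<open>A v\<close> with probability at least
  \<open>1 / 2 ^ d\<close>, independently for different \<open>v\<close> because the sets are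
  disjoint. In the induction, \<open>S\<close> splits into \<open>S \<inter> A v\<close>, a nonempty
  subset of \<open>A v\<close>, and \<open>S - A v\<close>, which still meets the other
  members.\<close>

lemma card_hitting_sets_le:
  assumes "finite F" and "finite L"
    and "\<And>v. v \<in> F \<Longrightarrow> A v \<subseteq> L" and "\<And>v. v \<in> F \<Longrightarrow> card (A v) \<le> d"
    and "\<And>u v. u \<in> F \<Longrightarrow> v \<in> F \<Longrightarrow> u \<noteq> v \<Longrightarrow> A u \<inter> A v = {}"
  shows "real (card {S. S \<subseteq> L \<and> (\<forall>v\<in>F. A v \<inter> S \<noteq> {})}) \<le> 2 ^ card L * (1 - 1 / 2 ^ d) ^ card F"
  using assms
proof (induction F arbitrary: L rule: finite_induct)
  case empty
  have "{S. S \<subseteq> L} = Pow L" by auto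
  then show ?case using empty by (simp add: card_Pow)
next
  case (insert v F)
  define H where "H K = {S. S \<subseteq> K \<and> (\<forall>u\<in>F. A u \<inter> S \<noteq> {})}" for K
  let ?H = "{S. S \<subseteq> L \<and> (\<forall>u\<in>insert v F. A u \<inter> S \<noteq> {})}"
  have fin: "finite (A v)" "A v \<subseteq> L" "card (A v) \<le> d"
    using insert.prems by (auto intro: finite_subset)
  have disj: "A u \<inter> A v = {}" if "u \<in> F" for u
    using insert.prems(4)[of u v] insert.hyps that by auto
  have IH: "real (card (H (L - A v))) \<le> 2 ^ card (L - A v) * (1 - 1 / 2 ^ d) ^ card F"
    unfolding H_def
  proof (rule insert.IH)
    show "A u \<subseteq> L - A v" if "u \<in> F" for u
      using insert.prems(2)[of u] disj[OF that] that by auto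
  qed (use insert.prems in auto)
  have finH: "finite (H (L - A v))"
    unfolding H_def using insert.prems(1) by (auto intro: finite_subset[of _ "Pow L"])
  have "card ?H \<le> card ((Pow (A v) - {{}}) \<times> H (L - A v))"
  proof (rule card_inj_on_le)
    show "inj_on (\<lambda>S. (S \<inter> A v, S - A v)) ?H"
      by (auto simp: inj_on_def)
    show "(\<lambda>S. (S \<inter> A v, S - A v)) ` ?H \<subseteq> (Pow (A v) - {{}}) \<times> H (L - A v)"
    proof (rule image_subsetI)
      fix S assume "S \<in> ?H"
      then have S: "S \<subseteq> L" "\<forall>u\<in>insert v F. A u \<inter> S \<noteq> {}" by auto
      have "A u \<inter> (S - A v) \<noteq> {}" if "u \<in> F" for u
        using S(2) disj[OF that] that by auto
      then show "(S \<inter> A v, S - A v) \<in> (Pow (A v) - {{}}) \<times> H (L - A v)"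
        using S unfolding H_def by auto
    qed
    show "finite ((Pow (A v) - {{}}) \<times> H (L - A v))" using fin finH by auto
  qed
  also have "\<dots> = (2 ^ card (A v) - 1) * card (H (L - A v))"
    using fin(1) by (simp add: card_cartesian_product card_Pow)
  finally have "real (card ?H) \<le> real ((2 ^ card (A v) - 1) * card (H (L - A v)))"
    using of_nat_le_iff by blast
  also have "\<dots> = (2 ^ card (A v) - 1) * real (card (H (L - A v)))"
    by (simp add: of_nat_diff)
  also have "\<dots> \<le> (2 ^ card (A v) - 1) * (2 ^ card (L - A v) * (1 - 1 / 2 ^ d) ^ card F)"
    by (intro mult_left_mono IH) simp
  also have "\<dots> \<le> (2 ^ card (A v) * (1 - 1 / 2 ^ d)) * (2 ^ card (L - A v) * (1 - 1 / 2 ^ d) ^ card F)"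
  proof (rule mult_right_mono)
    \<comment> \<open>With \<open>a = card (A v)\<close>, the count of nonempty subsets is
      \<open>2 ^ a - 1 = 2 ^ a * (1 - 1 / 2 ^ a)\<close>, and \<open>a \<le> d\<close>.\<close>
    have "(2::real) ^ card (A v) \<le> 2 ^ d" using fin(3) by (intro power_increasing) auto
    then show "(2::real) ^ card (A v) - 1 \<le> 2 ^ card (A v) * (1 - 1 / 2 ^ d)"
      by (simp add: field_simps)
  qed simp
  also have "\<dots> = (2 ^ (card (A v) + card (L - A v))) * (1 - 1 / 2 ^ d) ^ Suc (card F)"
    by (simp add: power_add)
  also have "card (A v) + card (L - A v) = card L"
    using fin insert.prems(1) by (simp add: card_Diff_subset card_mono)
  finally show ?case using insert.hyps by simp
qed

text \<open>For a maximal disjoint subfamily \<open>F\<close>, every member of \<open>B\<close>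
  equals or conflicts with a member of \<open>F\<close>, so \<open>card F\<close> conflict classes
  of size at most \<open>D\<close> cover \<open>B\<close>. The disjunct \<open>u = v\<close> matters
  when \<open>A v\<close> is empty: such a \<open>v\<close> does not meet itself.\<close>

lemma ex_pairwise_disjoint_subfamily:
  assumes "finite B" and "\<And>v. v \<in> B \<Longrightarrow> card {u \<in> B. u = v \<or> A u \<inter> A v \<noteq> {}} \<le> D"
  obtains F where "F \<subseteq> B" "\<And>u v. u \<in> F \<Longrightarrow> v \<in> F \<Longrightarrow> u \<noteq> v \<Longrightarrow> A u \<inter> A v = {}"
    "card B \<le> D * card F"
proof -
  define \<F> where "\<F> = {F. F \<subseteq> B \<and> (\<forall>u\<in>F. \<forall>v\<in>F. u \<noteq> v \<longrightarrow> A u \<inter> A v = {})}"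
  have "finite \<F>" using assms(1) by (auto simp: \<F>_def intro: finite_subset[of _ "Pow B"])
  moreover have "{} \<in> \<F>" by (simp add: \<F>_def)
  ultimately obtain F where F: "F \<in> \<F>" and max: "\<And>F'. F' \<in> \<F> \<Longrightarrow> F \<subseteq> F' \<Longrightarrow> F = F'"
    using finite_has_maximal[of \<F>] by auto
  have FB: "F \<subseteq> B" and Fdisj: "\<And>u v. u \<in> F \<Longrightarrow> v \<in> F \<Longrightarrow> u \<noteq> v \<Longrightarrow> A u \<inter> A v = {}"
    using F by (auto simp: \<F>_def)
  have finF: "finite F" using FB assms(1) by (rule finite_subset)
  have "B \<subseteq> (\<Union>v\<in>F. {u \<in> B. u = v \<or> A u \<inter> A v \<noteq> {}})"
  proof
    fix u assume "u \<in> B"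
    show "u \<in> (\<Union>v\<in>F. {u \<in> B. u = v \<or> A u \<inter> A v \<noteq> {}})"
    proof (rule ccontr)
      assume no: "\<not> ?thesis"
      then have "insert u F \<in> \<F>" using FB Fdisj \<open>u \<in> B\<close> by (auto simp: \<F>_def Int_commute)
      then have "F = insert u F" using max by blast
      then show False using no \<open>u \<in> B\<close> by auto
    qed
  qed
  then have "card B \<le> card (\<Union>v\<in>F. {u \<in> B. u = v \<or> A u \<inter> A v \<noteq> {}})"
    using assms(1) finF by (intro card_mono) auto
  also have "\<dots> \<le> (\<Sum>v\<in>F. card {u \<in> B. u = v \<or> A u \<inter> A v \<noteq> {}})"
    by (rule card_UN_le[OF finF])
  also have "\<dots> \<le> (\<Sum>v\<in>F. D)" using FB by (intro sum_mono assms(2)) auto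
  finally have "card B \<le> D * card F" by (simp add: mult.commute)
  with FB Fdisj show thesis by (rule that)
qed

section \<open>Connected dominating sets\<close>

text \<open>The library defines connectedness through the symmetrised digraph and
  \<open>rtrancl_on\<close>. The arcs of \<open>G\<close> are symmetric already, so symmetrising
  adds none, and both closures agree on paths that start in \<open>X\<close>.\<close>

lemma connected_induced_iff:
  assumes "pair_graph G"
  shows "Digraph_Component.connected (with_proj G \<restriction> X) \<longleftrightarrow>
    X \<noteq> {} \<and> (\<forall>u\<in>X. \<forall>v\<in>X. (u, v) \<in> (parcs G \<inter> X \<times> X)\<^sup>*)"
proof -
  interpret pair_graph G by fact
  have sym: "(v, u) \<in> parcs G" if "(u, v) \<in> parcs G" for u v
    using that pair_sym_arcs by (auto simp: symmetric_def sym_def)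
  have arcs: "parcs (mk_symmetric (with_proj G \<restriction> X)) = parcs G \<inter> X \<times> X"
    using sym by (auto simp: parcs_mk_symmetric induce_subgraph_def)
  have "(u, v) \<in> rtrancl_on X E \<longleftrightarrow> (u, v) \<in> E\<^sup>*" if "u \<in> X" "E \<subseteq> X \<times> X" for u v E
  proof
    assume "(u, v) \<in> rtrancl_on X E"
    then show "(u, v) \<in> E\<^sup>*" by induction auto
  next
    assume "(u, v) \<in> E\<^sup>*"
    then show "(u, v) \<in> rtrancl_on X E"
      using that by induction (auto intro: rtrancl_on_into_rtrancl_on)
  qed
  then have "u \<rightarrow>\<^sup>*\<^bsub>mk_symmetric (with_proj G \<restriction> X)\<^esub> v \<longleftrightarrow> (u, v) \<in> (parcs G \<inter> X \<times> X)\<^sup>*"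
    if "u \<in> X" for u v
    using that by (simp add: reachable_def arcs)
  then show ?thesis
    by (simp add: connected_def strongly_connected_def)
qed

lemma cds_iff:
  assumes "pair_graph G"
  shows "connected_dominating_set G X \<longleftrightarrow>
    X \<subseteq> pverts G \<and> (\<forall>v \<in> pverts G - X. \<exists>u\<in>X. u \<in> nbrs G v) \<and>
    X \<noteq> {} \<and> (\<forall>u\<in>X. \<forall>v\<in>X. (u, v) \<in> (parcs G \<inter> X \<times> X)\<^sup>*)"
  unfolding connected_dominating_set_def connected_induced_iff[OF assms] by blast

lemma nbrs_sym: "pair_graph G \<Longrightarrow> u \<in> nbrs G v \<longleftrightarrow> v \<in> nbrs G u"
proof -
  assume "pair_graph G"
  then interpret pair_graph G .
  show ?thesis using pair_sym_arcs by (auto simp: symmetric_def sym_def nbrs_def)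
qed

text \<open>By domination each added vertex has a neighbour in \<open>X\<close>, which joins it to
  the connected set \<open>X\<close>.\<close>

lemma cds_superset:
  assumes "pair_graph G" "connected_dominating_set G X" "X \<subseteq> Y" "Y \<subseteq> pverts G"
  shows "connected_dominating_set G Y"
proof -
  have X: "X \<subseteq> pverts G" "X \<noteq> {}"
    and dom: "\<And>v. v \<in> pverts G - X \<Longrightarrow> \<exists>u\<in>X. u \<in> nbrs G v"
    and conn: "\<And>u v. u \<in> X \<Longrightarrow> v \<in> X \<Longrightarrow> (u, v) \<in> (parcs G \<inter> X \<times> X)\<^sup>*"
    using assms(2) by (simp_all add: cds_iff[OF assms(1)])
  define E where "E = parcs G \<inter> Y \<times> Y"
  have "(parcs G \<inter> X \<times> X)\<^sup>* \<subseteq> E\<^sup>*"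
    unfolding E_def using assms(3) by (intro rtrancl_mono) auto
  then have XY: "(u, v) \<in> E\<^sup>*" if "u \<in> X" "v \<in> X" for u v
    using conn[OF that] by (rule subsetD)
  have near: "\<exists>x\<in>X. (y, x) \<in> E\<^sup>* \<and> (x, y) \<in> E\<^sup>*" if y: "y \<in> Y" for y
  proof (cases "y \<in> X")
    case False
    then obtain x where x: "x \<in> X" "x \<in> nbrs G y" using dom[of y] assms(4) y by auto
    then have "(y, x) \<in> E" "(x, y) \<in> E"
      using nbrs_sym[OF assms(1), of x y] assms(3) y by (auto simp: nbrs_def E_def)
    then show ?thesis using x by blast
  qed auto
  have "(u, v) \<in> E\<^sup>*" if "u \<in> Y" "v \<in> Y" for u v
    using near[OF that(1)] near[OF that(2)] XY by (meson rtrancl_trans)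
  moreover have "\<exists>u\<in>Y. u \<in> nbrs G v" if "v \<in> pverts G - Y" for v
    using dom[of v] that assms(3) by auto
  ultimately show ?thesis
    unfolding cds_iff[OF assms(1)] E_def using X assms(3,4) by simp blast
qed

text \<open>Starting from a vertex of \<open>X\<close>, iterating \<open>spread\<close> collects the vertices reachable by paths with
  all inner vertices in \<open>X\<close>; this tests connectedness and domination at once.\<close>

definition spread :: "'a pair_pre_digraph \<Rightarrow> 'a set \<Rightarrow> 'a set \<Rightarrow> 'a set" where
  "spread G X Q = {v \<in> pverts G. v \<in> Q \<or> nbrs G v \<inter> Q \<inter> X \<noteq> {}}"

text \<open>A collected vertex of \<open>X\<close> is joined to \<open>x\<close> inside
  \<open>X\<close>, and any other collected vertex has a neighbour in \<open>X\<close>; so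
  collecting everything suffices. Conversely, each round adds a vertex until all are
  collected.\<close>

lemma cds_iff_spread:
  assumes "pair_graph G" "X \<subseteq> pverts G" "x \<in> X"
  shows "connected_dominating_set G X \<longleftrightarrow> (spread G X ^^ card (pverts G)) {x} = pverts G"
proof -
  interpret pair_graph G by fact
  have fin: "finite (pverts G)" by (rule pair_finite_verts)
  define Q where "Q k = (spread G X ^^ k) {x}" for k
  have Q0: "Q 0 = {x}" and QS: "Q (Suc k) = spread G X (Q k)" for k by (simp_all add: Q_def)
  have QV: "Q k \<subseteq> pverts G" for k
    by (cases k) (use assms in \<open>auto simp: Q0 QS spread_def\<close>)
  have xQ: "x \<in> Q k" for k
    by (induction k) (use assms in \<open>auto simp: Q0 QS spread_def\<close>)
  have inc: "Q k \<subseteq> Q (Suc k)" for k using QV[of k] by (auto simp: QS spread_def)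
  let ?E = "parcs G \<inter> X \<times> X"
  have symE: "sym ?E"
    using pair_sym_arcs by (auto simp: symmetric_def sym_def)
  have reach: "(x, v) \<in> ?E\<^sup>*" if "v \<in> Q k" "v \<in> X" for k v
    using that
  proof (induction k arbitrary: v)
    case 0 then show ?case by (simp add: Q0)
  next
    case (Suc k)
    show ?case
    proof (cases "v \<in> Q k")
      case False
      then obtain u where u: "u \<in> nbrs G v" "u \<in> Q k" "u \<in> X"
        using Suc.prems by (auto simp: QS spread_def)
      have "(u, v) \<in> ?E"
        using u Suc.prems nbrs_sym[OF assms(1), of u v] by (auto simp: nbrs_def)
      then show ?thesis using Suc.IH[OF u(2,3)] by (rule rtrancl_into_rtrancl[rotated])
    qed (use Suc in auto)
  qed
  have dom: "\<exists>u\<in>X. u \<in> nbrs G v" if "v \<in> Q k" "v \<notin> X" for k v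
    using that
  proof (induction k)
    case 0 then show ?case using assms by (simp add: Q0)
  next
    case (Suc k) then show ?case by (auto simp: QS spread_def)
  qed
  show ?thesis
  proof
    assume "(spread G X ^^ card (pverts G)) {x} = pverts G"
    then have all: "Q (card (pverts G)) = pverts G" by (simp add: Q_def)
    have "(u, v) \<in> ?E\<^sup>*" if "u \<in> X" "v \<in> X" for u v
    proof -
      have "(x, u) \<in> ?E\<^sup>*" "(x, v) \<in> ?E\<^sup>*" using reach all assms(2) that by blast+
      then show ?thesis using sym_rtrancl[OF symE] by (meson rtrancl_trans symD)
    qed
    then show "connected_dominating_set G X"
      unfolding cds_iff[OF assms(1)] using assms(2,3) dom all by blast
  next
    assume "connected_dominating_set G X"
    note X = this[unfolded cds_iff[OF assms(1)]]
    \<comment> \<open>A stationary set contains all neighbours of its vertices in \<open>X\<close>.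
      Connectedness then puts \<open>X\<close> into it, and domination the rest.\<close>
    have closed: "Q k = pverts G" if "Q (Suc k) = Q k" for k
    proof -
      have step: "v \<in> Q k" if "u \<in> Q k" "u \<in> X" "v \<in> nbrs G u" for u v
      proof -
        have "u \<in> nbrs G v" "v \<in> pverts G"
          using that nbrs_sym[OF assms(1), of u v] arc_snd_in_verts[of "(u, v)"] by (auto simp: nbrs_def)
        then have "v \<in> Q (Suc k)" using that by (auto simp: QS spread_def)
        then show ?thesis using \<open>Q (Suc k) = Q k\<close> by simp
      qed
      have "v \<in> Q k" if "(x, v) \<in> ?E\<^sup>*" for v
        using that by induction (auto simp: xQ nbrs_def intro: step)
      then have "X \<subseteq> Q k" using X assms(3) by blast
      moreover have "v \<in> Q k" if "v \<in> pverts G - X" for v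
        using X that \<open>X \<subseteq> Q k\<close> step nbrs_sym[OF assms(1)] by blast
      ultimately show ?thesis using QV[of k] by blast
    qed
    \<comment> \<open>\<open>Q 0\<close> already has one vertex, so the inequality is strict; for
      \<open>k = card (pverts G)\<close> it is impossible.\<close>
    have grow: "Q k = pverts G \<or> k < card (Q k)" for k
    proof (induction k)
      case 0 then show ?case by (simp add: Q0)
    next
      case (Suc k)
      show ?case
      proof (cases "Q (Suc k) = Q k")
        case True then show ?thesis using closed by auto
      next
        case False
        then have "card (Q k) < card (Q (Suc k))"
          using inc[of k] finite_subset[OF QV fin] by (intro psubset_card_mono) auto
        moreover have "Q k \<noteq> pverts G" using False inc[of k] QV[of "Suc k"] by auto
        ultimately show ?thesis using Suc by auto
      qed
    qed
    have "Q (card (pverts G)) = pverts G"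
      using grow[of "card (pverts G)"] card_mono[OF fin QV] by (metis leD)
    then show "(spread G X ^^ card (pverts G)) {x} = pverts G" by (simp add: Q_def)
  qed
qed

section \<open>Extensions for an excellent partition\<close>

locale excellent_instance =
  fixes l :: nat and G :: "'a pair_pre_digraph" and L H R I O'
  assumes l: "l \<ge> 1" and G: "pair_graph G" and part: "excellent_partition l G L H R"
    and IO: "partition2 (H \<union> R) I O'"
    and low_degree: "real (card {v \<in> R. out_degree (with_proj G) v < 10 * l}) \<ge> real (card L) / 10"
begin

sublocale pair_graph G by (rule G)

abbreviation bound :: real where
  "bound \<equiv> 2 ^ card L * exp (- (real (card L) / (2 ^ (10 * l) * 100 * (real l)\<^sup>2)))"

lemma verts: "pverts G = L \<union> H \<union> R" "L \<inter> H = {}" "L \<inter> R = {}" "I \<union> O' = H \<union> R" "I \<inter> O' = {}"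
  using part IO
  by (auto simp: excellent_partition_def good_partition_def partition3_def partition2_def)

lemma finite_L: "finite L" and finite_R: "finite R"
  using pair_finite_verts verts by (auto intro: finite_subset)

lemma extension_iff: "extension G I O' S \<longleftrightarrow> S \<subseteq> L \<and> connected_dominating_set G (I \<union> S)"
  using verts unfolding extension_def by blast

lemma extension_superset:
  "extension G I O' S \<Longrightarrow> S \<subseteq> T \<Longrightarrow> T \<subseteq> L \<Longrightarrow> extension G I O' T"
  unfolding extension_iff using verts cds_superset[OF G, of "I \<union> S" "I \<union> T"] by blast

text \<open>Extensions are closed upwards within \<open>L\<close>: an extension
  \<open>T \<subset> S\<close> makes \<open>S - {x}\<close> an extension for every \<open>x\<close>
  in \<open>S - T\<close>.\<close>

lemma minimal_extension_iff:
  "minimal_extension G I O' S \<longleftrightarrow> extension G I O' S \<and> (\<forall>x\<in>S. \<not> extension G I O' (S - {x}))"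
proof -
  have "\<exists>x\<in>S. extension G I O' (S - {x})"
    if ext: "extension G I O' S" "extension G I O' T" and "T \<subset> S" for T
  proof -
    obtain x where x: "x \<in> S" "T \<subseteq> S - {x}" using \<open>T \<subset> S\<close> by blast
    have "S - {x} \<subseteq> L" using ext by (auto simp: extension_iff)
    then show ?thesis using extension_superset[OF ext(2) x(2)] x(1) by blast
  qed
  then show ?thesis unfolding minimal_extension_def by blast
qed

lemma nbrs_R: assumes "v \<in> R" shows "nbrs G v \<subseteq> L"
proof
  fix u assume u: "u \<in> nbrs G v"
  have "arcs (with_proj G \<restriction> (H \<union> R)) = {}" using part by (simp add: excellent_partition_def)
  then have "u \<notin> H \<union> R" using u assms by (auto simp: nbrs_def induce_subgraph_def)
  moreover have "u \<in> pverts G" using u arc_snd_in_verts[of "(v, u)"] by (auto simp: nbrs_def)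
  ultimately show "u \<in> L" using verts by blast
qed

text \<open>As \<open>nbrs G v\<close> lies in \<open>L\<close>, it misses \<open>I\<close>, and a
  neighbour of \<open>v\<close> in \<open>I \<union> S\<close> must be in \<open>S\<close>. For
  \<open>v\<close> in \<open>I\<close> it is the first step of a path from \<open>v\<close> to a
  vertex of \<open>S\<close>, which is nonempty by the first assumption.\<close>

lemma extension_meets_nbrs:
  assumes "\<not> extension G I O' {}" "extension G I O' S" "v \<in> R"
  shows "nbrs G v \<inter> S \<noteq> {}"
proof -
  note ext = assms(2)[unfolded extension_iff cds_iff[OF G]]
  have disj: "nbrs G v \<inter> I = {}" using nbrs_R[OF assms(3)] verts by blast
  have "S \<noteq> {}" using assms(1,2) by blast
  have "v \<notin> S" using ext assms(3) verts by blast
  have "\<exists>u. u \<in> nbrs G v \<and> u \<in> I \<union> S"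
  proof (cases "v \<in> I")
    case True
    obtain s where "s \<in> S" using \<open>S \<noteq> {}\<close> by blast
    then have "(v, s) \<in> (parcs G \<inter> (I \<union> S) \<times> (I \<union> S))\<^sup>*" "v \<noteq> s"
      using ext True \<open>v \<notin> S\<close> by auto
    then show ?thesis by (auto simp: nbrs_def elim: converse_rtranclE)
  next
    case False
    then show ?thesis using ext \<open>v \<notin> S\<close> verts assms(3) by blast
  qed
  then show ?thesis using disj by blast
qed

text \<open>A vertex in conflict with \<open>v\<close> is reached from \<open>v\<close> through one
  of fewer than \<open>10 * l\<close> vertices of \<open>L\<close>, each with fewer than
  \<open>l\<close> neighbours in \<open>R\<close>.\<close>

lemma card_low_degree_conflicts_le:
  assumes "v \<in> R" "card (nbrs G v) < 10 * l"
  shows "card {u \<in> R. u = v \<or> nbrs G u \<inter> nbrs G v \<noteq> {}} \<le> 10 * l\<^sup>2"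
proof -
  have finN: "finite (nbrs G v)" using nbrs_R[OF assms(1)] finite_L by (rule finite_subset)
  have "{u \<in> R. u = v \<or> nbrs G u \<inter> nbrs G v \<noteq> {}} \<subseteq> {v} \<union> (\<Union>x\<in>nbrs G v. nbrs G x \<inter> R)"
    using nbrs_sym[OF G] by blast
  then have "card {u \<in> R. u = v \<or> nbrs G u \<inter> nbrs G v \<noteq> {}} \<le> card ({v} \<union> (\<Union>x\<in>nbrs G v. nbrs G x \<inter> R))"
    using finN finite_R by (intro card_mono) auto
  also have "\<dots> \<le> 1 + card (\<Union>x\<in>nbrs G v. nbrs G x \<inter> R)"
    using card_Un_le[of "{v}"] by simp
  also have "\<dots> \<le> 1 + (\<Sum>x\<in>nbrs G v. card (nbrs G x \<inter> R))"
    using card_UN_le[OF finN, of "\<lambda>x. nbrs G x \<inter> R"] by (rule add_left_mono)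
  also have "\<dots> \<le> 1 + (\<Sum>x\<in>nbrs G v. l)"
    using part nbrs_R[OF assms(1)]
    by (intro add_left_mono sum_mono less_imp_le)
       (auto simp: excellent_partition_def good_partition_def)
  \<comment> \<open>The summand 1 for \<open>v\<close> itself is paid by one more \<open>l\<close>;
    the strict degree bound leaves room for it.\<close>
  also have "\<dots> \<le> Suc (card (nbrs G v)) * l" using l by simp
  also have "\<dots> \<le> 10 * l * l" using assms(2) by (intro mult_right_mono) auto
  finally show ?thesis by (simp add: power2_eq_square)
qed

text \<open>The assumption is essential: if the empty set is an extension, then so are all
  \<open>2 ^ card L\<close> subsets of \<open>L\<close>.\<close>

lemma card_extensions_le:
  assumes "\<not> extension G I O' {}"
  shows "real (card {S. extension G I O' S}) \<le> bound"
proof -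
  let ?B = "{v \<in> R. out_degree (with_proj G) v < 10 * l}"
  have deg: "out_degree (with_proj G) v = card (nbrs G v)" for v
  proof -
    have "out_arcs (with_proj G) v = Pair v ` nbrs G v" by (auto simp: out_arcs_def nbrs_def)
    then show ?thesis by (simp add: out_degree_def card_image inj_on_def)
  qed
  have conf: "card {u \<in> ?B. u = v \<or> nbrs G u \<inter> nbrs G v \<noteq> {}} \<le> 10 * l\<^sup>2" if "v \<in> ?B" for v
    using card_low_degree_conflicts_le[of v] that finite_R
    by (intro order_trans[OF card_mono card_low_degree_conflicts_le[of v]]) (auto simp: deg)
  obtain F where F: "F \<subseteq> ?B"
      "\<And>u v. u \<in> F \<Longrightarrow> v \<in> F \<Longrightarrow> u \<noteq> v \<Longrightarrow> nbrs G u \<inter> nbrs G v = {}"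
      "card ?B \<le> 10 * l\<^sup>2 * card F"
    using ex_pairwise_disjoint_subfamily[of ?B "nbrs G", OF _ conf] finite_R by auto
  have finF: "finite F" using F(1) finite_R by (auto intro: finite_subset)
  have "real (card L) / 10 \<le> real (10 * l\<^sup>2 * card F)"
    using F(3) low_degree of_nat_le_iff[of "card ?B" "10 * l\<^sup>2 * card F", where 'a = real] by linarith
  then have cardF: "real (card L) / (100 * (real l)\<^sup>2) \<le> real (card F)"
    using l by (simp add: field_simps)
  have "{S. extension G I O' S} \<subseteq> {S. S \<subseteq> L \<and> (\<forall>v\<in>F. nbrs G v \<inter> S \<noteq> {})}"
    using extension_meets_nbrs[OF assms] F(1) by (auto simp: extension_iff)
  then have "real (card {S. extension G I O' S})
      \<le> real (card {S. S \<subseteq> L \<and> (\<forall>v\<in>F. nbrs G v \<inter> S \<noteq> {})})"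
    using finite_L by (intro of_nat_mono card_mono) (auto intro: finite_subset[of _ "Pow L"])
  also have "\<dots> \<le> 2 ^ card L * (1 - 1 / 2 ^ (10 * l)) ^ card F"
  proof (rule card_hitting_sets_le[OF finF finite_L])
    show "nbrs G v \<subseteq> L" "card (nbrs G v) \<le> 10 * l" if "v \<in> F" for v
      using F(1) that nbrs_R by (auto simp: deg)
  qed (fact F(2))
  \<comment> \<open>This is \<open>1 - x \<le> exp (- x)\<close>; the lower bound
    \<open>cardF\<close> then gives the required exponent.\<close>
  also have "(1 - 1 / 2 ^ (10 * l) :: real) ^ card F \<le> exp (- (1 / 2 ^ (10 * l))) ^ card F"
    using exp_ge_add_one_self[of "- (1 / 2 ^ (10 * l))"] by (intro power_mono) auto
  also have "\<dots> = exp (- (real (card F) / 2 ^ (10 * l)))"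
    by (simp flip: exp_of_nat_mult)
  also have "\<dots> \<le> exp (- (real (card L) / (2 ^ (10 * l) * 100 * (real l)\<^sup>2)))"
    using divide_right_mono[OF cardF, of "2 ^ (10 * l)"] by (simp add: mult_ac)
  finally show ?thesis by simp
qed

text \<open>The denominator is at least 2 and \<open>1 / 2 \<le> ln 2\<close>, so the exponential is
  at least \<open>1 / 2 ^ card L\<close>. This covers the cases with a single minimal extension or a
  single leaf.\<close>

lemma bound_ge_1: "1 \<le> bound"
proof -
  have "(2::real) \<le> 2 ^ (10 * l)" using power_increasing[of 1 "10 * l" "2::real"] l by simp
  moreover have "1 \<le> 100 * (real l)\<^sup>2"
    using l by (metis one_le_power mult_mono' mult_1 of_nat_1 of_nat_mono
        one_le_numeral zero_le_one)
  ultimately have "2 * 1 \<le> 2 ^ (10 * l) * (100 * (real l)\<^sup>2)"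
    by (intro mult_mono) auto
  then have "real (card L) / (2 ^ (10 * l) * 100 * (real l)\<^sup>2) \<le> real (card L) / 2"
    by (intro divide_left_mono) (auto simp: mult_ac)
  also have "\<dots> \<le> real (card L) * ln 2"
  proof -
    have "1 / 2 \<le> ln (2::real)" using exp_half_le2 by (subst ln_ge_iff) auto
    then have "real (card L) * (1 / 2) \<le> real (card L) * ln 2" by (rule mult_left_mono) simp
    then show ?thesis by simp
  qed
  finally have "exp (- (real (card L) * ln 2))
      \<le> exp (- (real (card L) / (2 ^ (10 * l) * 100 * (real l)\<^sup>2)))" by simp
  then have "2 ^ card L * exp (- (real (card L) * ln 2)) \<le> bound"
    by (intro mult_left_mono) auto
  moreover have "2 ^ card L * exp (- (real (card L) * ln 2)) = 1"
    by (simp add: exp_minus exp_of_nat_mult)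
  ultimately show ?thesis by simp
qed

lemma minimal_extensions_if_empty_extension:
  "extension G I O' {} \<Longrightarrow> {S. minimal_extension G I O' S} = {{}}"
  unfolding minimal_extension_def by blast

lemma card_minimal_extensions_le: "real (card {S. minimal_extension G I O' S}) \<le> bound"
proof (cases "extension G I O' {}")
  case True
  then show ?thesis using bound_ge_1 by (simp add: minimal_extensions_if_empty_extension)
next
  case False
  have "card {S. minimal_extension G I O' S} \<le> card {S. extension G I O' S}"
    using finite_L
    by (intro card_mono finite_subset[of "{S. extension G I O' S}" "Pow L"])
       (auto simp: extension_iff minimal_extension_def)
  then show ?thesis using card_extensions_le[OF False] by linarith
qed

end

section \<open>The program\<close>

definition eval_le :: "program \<Rightarrow> data list \<Rightarrow> expr \<Rightarrow> data \<Rightarrow> nat \<Rightarrow> bool" where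
  "eval_le p env e v T \<longleftrightarrow> (\<exists>t\<le>T. eval p env e v t)"

definition evals_le :: "program \<Rightarrow> data list \<Rightarrow> expr list \<Rightarrow> data list \<Rightarrow> nat \<Rightarrow> bool" where
  "evals_le p env es vs T \<longleftrightarrow> (\<exists>t\<le>T. evals p env es vs t)"

text \<open>Applied first in most evaluation proofs: the time \<open>S\<close> stays schematic, the
  following rules build it up along the expression, and one inequality is left at the end.\<close>

lemma eval_le_mono: "eval_le p env e v S \<Longrightarrow> S \<le> T \<Longrightarrow> eval_le p env e v T"
  unfolding eval_le_def by (meson le_trans)

lemma eval_le_Var:
  "eval_le p (a # env) (Var 0) a 1"
  "eval_le p (a # b # env) (Var 1) b 1"
  "eval_le p (a # b # c # env) (Var 2) c 1"
  "eval_le p (a # b # c # d # env) (Var 3) d 1"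
  "eval_le p (a # b # c # d # e # env) (Var 4) e 1"
  unfolding eval_le_def
  using eval_Var[of 0 "a # env" p] eval_Var[of 1 "a # b # env" p] eval_Var[of 2 "a # b # c # env" p]
    eval_Var[of 3 "a # b # c # d # env" p] eval_Var[of 4 "a # b # c # d # e # env" p]
  by (auto simp: numeral_eq_Suc)

lemma eval_le_Null: "eval_le p env ENull Null 1"
  unfolding eval_le_def using eval_Null by blast

lemma eval_le_Cell:
  "eval_le p env a x S \<Longrightarrow> eval_le p env b y T \<Longrightarrow> eval_le p env (ECell a b) (Cell x y) (S + T + 1)"
  unfolding eval_le_def using eval_Cell by (meson add_le_mono order_refl)

lemma eval_le_Fst: "eval_le p env a (Cell x y) T \<Longrightarrow> eval_le p env (Fst a) x (T + 1)"
  unfolding eval_le_def using eval_Fst[of p env a "Cell x y"] by fastforce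

lemma eval_le_Snd: "eval_le p env a (Cell x y) T \<Longrightarrow> eval_le p env (Snd a) y (T + 1)"
  unfolding eval_le_def using eval_Snd[of p env a "Cell x y"] by fastforce

lemma eval_le_If_Cell:
  "eval_le p env c (Cell x y) S \<Longrightarrow> eval_le p env a v T \<Longrightarrow> eval_le p env (IfCell c a b) v (S + T + 1)"
  unfolding eval_le_def using eval_If_Cell by (meson add_le_mono order_refl)

lemma eval_le_If_Null:
  "eval_le p env c Null S \<Longrightarrow> eval_le p env b v T \<Longrightarrow> eval_le p env (IfCell c a b) v (S + T + 1)"
  unfolding eval_le_def using eval_If_Null by (meson add_le_mono order_refl)

lemma evals_le_Nil: "evals_le p env [] [] 0"
  unfolding evals_le_def using evals_Nil by blast

lemma evals_le_Cons:
  "eval_le p env e v S \<Longrightarrow> evals_le p env es vs T \<Longrightarrow> evals_le p env (e # es) (v # vs) (S + T)"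
  unfolding eval_le_def evals_le_def using evals_Cons by (meson add_le_mono)

lemma eval_le_Call:
  "evals_le p env es vs S \<Longrightarrow> f < length p \<Longrightarrow> eval_le p vs (p ! f) v T \<Longrightarrow>
    eval_le p env (Call f es) v (S + T + 1)"
  unfolding eval_le_def evals_le_def using eval_Call by (meson add_le_mono order_refl)

lemma eval_le_test_Cell:
  "eval_le p env c (Cell x y) 1 \<Longrightarrow> eval_le p env a v T \<Longrightarrow> eval_le p env (IfCell c a b) v (T + 2)"
  using eval_le_If_Cell[of p env c x y 1 a v T b] by simp

lemma eval_le_test_Null:
  "eval_le p env c Null 1 \<Longrightarrow> eval_le p env b v T \<Longrightarrow> eval_le p env (IfCell c a b) v (T + 2)"
  using eval_le_If_Null[of p env c 1 b v T a] by simp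

lemmas eval_le_If_Var =
  eval_le_test_Cell[OF eval_le_Var(1)] eval_le_test_Null[OF eval_le_Var(1)]
  eval_le_test_Cell[OF eval_le_Var(2)] eval_le_test_Null[OF eval_le_Var(2)]
  eval_le_test_Cell[OF eval_le_Var(3)] eval_le_test_Null[OF eval_le_Var(3)]
  eval_le_test_Cell[OF eval_le_Var(4)] eval_le_test_Null[OF eval_le_Var(4)]

definition enc_bool :: "bool \<Rightarrow> data" where
  "enc_bool b = (if b then Cell Null Null else Null)"

lemma eval_le_true: "b \<Longrightarrow> eval_le p env (ECell ENull ENull) (enc_bool b) 3"
  by (simp add: enc_bool_def, rule eval_le_mono, (rule eval_le_Cell eval_le_Null)+, simp)

lemma eval_le_false: "\<not> b \<Longrightarrow> eval_le p env ENull (enc_bool b) 1"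
  using eval_le_Null by (simp add: enc_bool_def)

lemma eval_le_If_true:
  "eval_le p env c (enc_bool q) S \<Longrightarrow> q \<Longrightarrow> eval_le p env a v T \<Longrightarrow>
    eval_le p env (IfCell c a b) v (S + T + 1)"
  using eval_le_If_Cell[of p env c Null Null S a v T b] by (simp add: enc_bool_def)

lemma eval_le_If_false:
  "eval_le p env c (enc_bool q) S \<Longrightarrow> \<not> q \<Longrightarrow> eval_le p env b v T \<Longrightarrow>
    eval_le p env (IfCell c a b) v (S + T + 1)"
  using eval_le_If_Null[of p env c S b v T a] by (simp add: enc_bool_def)

text \<open>Tests of variables are included, since the shape of the value selects the branch by
  unification. Tests of computed truth values are not: there the branch depends on a fact that has
  to be supplied.\<close>

lemmas eval_le_basic =
  eval_le_Var eval_le_Null eval_le_Cell eval_le_Fst eval_le_Snd evals_le_Nil evals_le_Cons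
  eval_le_Call eval_le_If_Var

section \<open>The functions of the enumeration algorithm\<close>

abbreviation (input) fn_same_length :: nat where "fn_same_length \<equiv> 1"
abbreviation (input) fn_member :: nat where "fn_member \<equiv> 2"
abbreviation (input) fn_meets :: nat where "fn_meets \<equiv> 3"
abbreviation (input) fn_spread :: nat where "fn_spread \<equiv> 4"
abbreviation (input) fn_iterate :: nat where "fn_iterate \<equiv> 5"
abbreviation (input) fn_cds :: nat where "fn_cds \<equiv> 6"
abbreviation (input) fn_append :: nat where "fn_append \<equiv> 7"
abbreviation (input) fn_minimal :: nat where "fn_minimal \<equiv> 8"
abbreviation (input) fn_enum :: nat where "fn_enum \<equiv> 9"
abbreviation (input) fn_rev :: nat where "fn_rev \<equiv> 10"

text \<open>In the first branch \<open>ECell ENull ENull\<close> encodes the list whose only member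
  is the empty set. Treating this case apart is needed for the time bound, because otherwise no
  branch would ever be pruned. If even \<open>I \<union> L\<close> fails the test, there is no
  extension.\<close>

definition main_body :: expr where
  "main_body =
    (let g = Fst (Snd (Var 0)); ls = Fst (Snd (Snd (Var 0)));
         is = Fst (Snd (Snd (Snd (Snd (Snd (Var 0))))))
     in IfCell (Call fn_cds [g, is])
          (ECell ENull ENull)
          (IfCell (Call fn_cds [g, Call fn_append [is, ls]])
            (Call fn_enum [g, is, ENull, Call fn_rev [ls, ENull], ENull])
            ENull))"

text \<open>Serves both as equality of unary numbers and as comparison of list lengths.\<close>

definition same_length_body :: expr where
  "same_length_body =
    IfCell (Var 0)
      (IfCell (Var 1) (Call fn_same_length [Snd (Var 0), Snd (Var 1)]) ENull)
      (IfCell (Var 1) ENull (ECell ENull ENull))"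

definition member_body :: expr where
  "member_body =
    IfCell (Var 1)
      (IfCell (Call fn_same_length [Var 0, Fst (Var 1)])
        (ECell ENull ENull)
        (Call fn_member [Var 0, Snd (Var 1)]))
      ENull"

definition meets_body :: expr where
  "meets_body =
    (let rec = Call fn_meets [Snd (Var 0), Var 1, Var 2]
     in IfCell (Var 0)
          (IfCell (Call fn_member [Fst (Var 0), Var 1])
            (IfCell (Call fn_member [Fst (Var 0), Var 2]) (ECell ENull ENull) rec)
            rec)
          ENull)"

text \<open>\<open>Var 1\<close> is the vertex whose adjacency list is at the head of
  \<open>Var 0\<close>; it is incremented along the way.\<close>

definition spread_body :: expr where
  "spread_body =
    (let rec = Call fn_spread [Snd (Var 0), ECell ENull (Var 1), Var 2, Var 3]
     in IfCell (Var 0)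
          (IfCell (Call fn_member [Var 1, Var 2])
            (ECell (Var 1) rec)
            (IfCell (Call fn_meets [Fst (Var 0), Var 2, Var 3]) (ECell (Var 1) rec) rec))
          ENull)"

definition iterate_body :: expr where
  "iterate_body =
    IfCell (Var 0)
      (Call fn_iterate [Snd (Var 0), Var 1, Call fn_spread [Var 1, ENull, Var 2, Var 3], Var 3])
      (Var 2)"

text \<open>The list of adjacency lists serves three purposes here: as the graph, as the counter for \<open>n\<close>
  iterations, and as the list of length \<open>n\<close> that the result is compared with.\<close>

definition cds_body :: expr where
  "cds_body =
    IfCell (Var 1)
      (Call fn_same_length
        [Call fn_iterate [Var 0, Var 0, ECell (Fst (Var 1)) ENull, Var 1], Var 0])
      ENull"

definition append_body :: expr where
  "append_body =
    IfCell (Var 0) (ECell (Fst (Var 0)) (Call fn_append [Snd (Var 0), Var 1])) (Var 1)"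

text \<open>\<open>Var 1\<close> holds \<open>I\<close> and the vertices already tested,
  \<open>Var 2\<close> those still to be tested.\<close>

definition minimal_body :: expr where
  "minimal_body =
    IfCell (Var 2)
      (IfCell (Call fn_cds [Var 0, Call fn_append [Var 1, Snd (Var 2)]])
        ENull
        (Call fn_minimal [Var 0, ECell (Fst (Var 2)) (Var 1), Snd (Var 2)]))
      (ECell ENull ENull)"

text \<open>The arguments are the graph, \<open>I\<close>, the chosen vertices, the undecided vertices in decreasing order
  (so that the chosen ones stay sorted), and an accumulator for the result.\<close>

definition enum_body :: expr where
  "enum_body =
    (let rec = Call fn_enum [Var 0, Var 1, ECell (Fst (Var 3)) (Var 2), Snd (Var 3), Var 4]
     in IfCell (Var 3)
          (IfCell (Call fn_cds [Var 0, Call fn_append [Var 1, Call fn_append [Var 2, Snd (Var 3)]]])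
            (Call fn_enum [Var 0, Var 1, Var 2, Snd (Var 3), rec])
            rec)
          (IfCell (Call fn_minimal [Var 0, Var 1, Var 2]) (ECell (Var 2) (Var 4)) (Var 4)))"

definition rev_body :: expr where
  "rev_body = IfCell (Var 0) (Call fn_rev [Snd (Var 0), ECell (Fst (Var 0)) (Var 1)]) (Var 1)"

definition prog :: program where
  "prog = [main_body, same_length_body, member_body, meets_body, spread_body, iterate_body,
    cds_body, append_body, minimal_body, enum_body, rev_body]"

lemma prog_nth:
  "prog ! 0 = main_body" "prog ! 1 = same_length_body" "prog ! 2 = member_body"
  "prog ! 3 = meets_body" "prog ! 4 = spread_body" "prog ! 5 = iterate_body"
  "prog ! 6 = cds_body" "prog ! 7 = append_body" "prog ! 8 = minimal_body"
  "prog ! 9 = enum_body" "prog ! 10 = rev_body"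
  by (simp_all add: prog_def)

lemma prog_length:
  "1 < length prog" "2 < length prog" "3 < length prog" "4 < length prog" "5 < length prog"
  "6 < length prog" "7 < length prog" "8 < length prog" "9 < length prog" "10 < length prog"
  by (simp_all add: prog_def)

section \<open>Evaluation of the list functions\<close>

fun spine :: "data \<Rightarrow> nat" where
  "spine Null = 0"
| "spine (Cell x y) = Suc (spine y)"

lemma spine_enc_nat [simp]: "spine (enc_nat k) = k"
  by (induction k) auto

lemma spine_enc_list [simp]: "spine (enc_list f xs) = length xs"
  by (induction xs) auto

abbreviation enc_nats :: "nat list \<Rightarrow> data" where
  "enc_nats \<equiv> enc_list enc_nat"

text \<open>Stated for arbitrary trees, to cover numbers as well as lists of different kinds. The
  recursion ends with the shorter spine, so the first argument alone bounds the time.\<close>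

lemma same_length_eval:
  "eval_le prog [x, y] (prog ! 1) (enc_bool (spine x = spine y)) (10 * spine x + 10)"
proof (induction x arbitrary: y)
  case Null
  show ?case
  proof (cases y)
    case Null
    show ?thesis unfolding prog_nth same_length_body_def Null
      by (rule eval_le_mono, (rule eval_le_If_Var)+, rule eval_le_true, simp_all)
  next
    case (Cell a b)
    show ?thesis unfolding prog_nth same_length_body_def Cell
      by (rule eval_le_mono, (rule eval_le_If_Var)+, rule eval_le_false, simp_all)
  qed
next
  case (Cell u x)
  show ?case
  proof (cases y)
    case Null
    show ?thesis unfolding prog_nth same_length_body_def Null
      by (rule eval_le_mono, (rule eval_le_If_Var)+, rule eval_le_false, simp_all)
  next
    case c: (Cell a b)
    have "(spine (Cell u x) = spine y) = (spine x = spine b)" using c by simp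
    then show ?thesis
      unfolding prog_nth same_length_body_def c
      by (simp only:) (rule eval_le_mono,
          (rule eval_le_basic prog_length Cell.IH(2))+, simp)
  qed
qed

lemma member_eval:
  assumes "a \<le> M"
  shows "eval_le prog [enc_nat a, enc_nats xs] (prog ! 2) (enc_bool (a \<in> set xs))
    (length xs * (10 * M + 40) + 5)"
proof (induction xs)
  case Nil
  show ?case unfolding prog_nth member_body_def enc_list.simps
    by (rule eval_le_mono, (rule eval_le_If_Var)+, rule eval_le_false, simp_all)
next
  case (Cons x xs)
  show ?case
  proof (cases "a = x")
    case True
    show ?thesis unfolding prog_nth member_body_def enc_list.simps
      by (rule eval_le_mono, rule eval_le_basic, rule eval_le_If_true,
          (rule eval_le_basic prog_length same_length_eval)+, simp add: True,
          rule eval_le_true, simp add: True, use assms in simp)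
  next
    case False
    then have eq: "(a \<in> set (x # xs)) = (a \<in> set xs)" by simp
    show ?thesis unfolding prog_nth member_body_def enc_list.simps eq
      by (rule eval_le_mono, rule eval_le_basic, rule eval_le_If_false,
          (rule eval_le_basic prog_length same_length_eval)+, simp add: False,
          (rule eval_le_basic prog_length Cons.IH)+, use assms in simp)
  qed
qed

definition member_time :: "nat \<Rightarrow> nat" where
  "member_time M = M * (10 * M + 40) + 5"

lemma member_eval':
  assumes "a \<le> M" "length xs \<le> M"
  shows "eval_le prog [enc_nat a, enc_nats xs] (prog ! 2) (enc_bool (a \<in> set xs)) (member_time M)"
  using member_eval[OF assms(1)] by (rule eval_le_mono)
    (use assms(2) in \<open>unfold member_time_def, intro add_right_mono mult_right_mono, auto\<close>)

lemma meets_eval: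
  assumes "\<And>a. a \<in> set as \<Longrightarrow> a \<le> M" "length Q \<le> M" "length X \<le> M"
  shows "eval_le prog [enc_nats as, enc_nats Q, enc_nats X] (prog ! 3)
    (enc_bool (\<exists>a\<in>set as. a \<in> set Q \<and> a \<in> set X)) (length as * (2 * member_time M + 40) + 5)"
  using assms(1)
proof (induction as)
  case Nil
  show ?case unfolding prog_nth meets_body_def enc_list.simps Let_def
    by (rule eval_le_mono, (rule eval_le_If_Var)+, rule eval_le_false, simp_all)
next
  case (Cons x as)
  have a: "x \<le> M" using Cons.prems by simp
  have IH: "eval_le prog [enc_nats as, enc_nats Q, enc_nats X] (prog ! 3)
    (enc_bool (\<exists>a\<in>set as. a \<in> set Q \<and> a \<in> set X)) (length as * (2 * member_time M + 40) + 5)"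
    using Cons by simp
  note memQ = member_eval'[OF a assms(2)] and memX = member_eval'[OF a assms(3)]
  consider "x \<in> set Q" "x \<in> set X" | "x \<in> set Q" "x \<notin> set X" | "x \<notin> set Q" by blast
  then show ?case
  proof cases
    case 1
    show ?thesis unfolding prog_nth meets_body_def enc_list.simps Let_def
      by (rule eval_le_mono, rule eval_le_basic, rule eval_le_If_true,
          (rule eval_le_basic prog_length memQ)+, rule 1, rule eval_le_If_true,
          (rule eval_le_basic prog_length memX)+, rule 1, rule eval_le_true,
          use 1 in simp, simp)
  next
    case 2
    then have eq: "(\<exists>a\<in>set (x # as). a \<in> set Q \<and> a \<in> set X) = (\<exists>a\<in>set as. a \<in> set Q \<and> a \<in> set X)"
      by simp
    show ?thesis unfolding prog_nth meets_body_def enc_list.simps Let_def eq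
      by (rule eval_le_mono, rule eval_le_basic, rule eval_le_If_true,
          (rule eval_le_basic prog_length memQ)+, rule 2, rule eval_le_If_false,
          (rule eval_le_basic prog_length memX)+, rule 2,
          (rule eval_le_basic prog_length IH)+, simp)
  next
    case 3
    then have eq: "(\<exists>a\<in>set (x # as). a \<in> set Q \<and> a \<in> set X) = (\<exists>a\<in>set as. a \<in> set Q \<and> a \<in> set X)"
      by simp
    show ?thesis unfolding prog_nth meets_body_def enc_list.simps Let_def eq
      by (rule eval_le_mono, rule eval_le_basic, rule eval_le_If_false,
          (rule eval_le_basic prog_length memQ)+, rule 3,
          (rule eval_le_basic prog_length IH)+, simp)
  qed
qed

lemma append_eval:
  "eval_le prog [enc_list f xs, enc_list f ys] (prog ! 7) (enc_list f (xs @ ys)) (length xs * 20 + 5)"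
proof (induction xs)
  case Nil
  show ?case unfolding prog_nth append_body_def enc_list.simps append.simps
    by (rule eval_le_mono, (rule eval_le_basic)+, simp)
next
  case (Cons x xs)
  show ?case unfolding prog_nth append_body_def enc_list.simps append.simps
    by (rule eval_le_mono, (rule eval_le_basic prog_length Cons.IH)+, simp)
qed

lemma rev_eval:
  "eval_le prog [enc_list f xs, enc_list f ys] (prog ! 10) (enc_list f (rev xs @ ys))
    (length xs * 20 + 5)"
proof (induction xs arbitrary: ys)
  case Nil
  have eq: "rev [] @ ys = ys" by simp
  show ?case unfolding prog_nth rev_body_def enc_list.simps eq
    by (rule eval_le_mono, (rule eval_le_basic)+, simp)
next
  case (Cons x xs)
  have eq: "rev (x # xs) @ ys = rev xs @ (x # ys)" by simp
  show ?case unfolding prog_nth rev_body_def enc_list.simps eq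
    by (rule eval_le_mono,
        (rule eval_le_basic prog_length Cons.IH[of "x # ys", unfolded enc_list.simps(2)])+, simp)
qed

section \<open>Evaluation of the graph functions\<close>

text \<open>The time analysis only needs a common bound \<open>M\<close> on numbers and list
  lengths. The strict inequality gives \<open>1 \<le> M\<close>, also for
  \<open>n = 0\<close>.\<close>

locale adjacency_lists =
  fixes n :: nat and nb :: "nat \<Rightarrow> nat list" and M :: nat
  assumes n_le: "n < M"
    and length_nb: "v < n \<Longrightarrow> length (nb v) \<le> M" and nb_le: "v < n \<Longrightarrow> a \<in> set (nb v) \<Longrightarrow> a \<le> M"
begin

abbreviation adj :: "nat list \<Rightarrow> data" where
  "adj \<equiv> enc_list (\<lambda>v. enc_nats (nb v))"

definition spread_list :: "nat list \<Rightarrow> nat list \<Rightarrow> nat list" where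
  "spread_list X Q = filter (\<lambda>v. v \<in> set Q \<or> (\<exists>a\<in>set (nb v). a \<in> set Q \<and> a \<in> set X)) [0..<n]"

definition meets_time :: nat where
  "meets_time = M * (2 * member_time M + 40) + 5"

definition spread_time :: nat where
  "spread_time = M * (member_time M + meets_time + 60) + 5"

definition cds_time :: nat where
  "cds_time = M * (spread_time + 40) + 10 * M + 60"

lemma meets_eval':
  assumes "v < n" "length Q \<le> M" "length X \<le> M"
  shows "eval_le prog [enc_nats (nb v), enc_nats Q, enc_nats X] (prog ! 3)
    (enc_bool (\<exists>a\<in>set (nb v). a \<in> set Q \<and> a \<in> set X)) meets_time"
  by (rule eval_le_mono, rule meets_eval[OF nb_le])
    (use assms length_nb in \<open>unfold meets_time_def, auto intro: add_right_mono mult_right_mono\<close>)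

text \<open>Generalised to the suffix from \<open>v\<close> on, with induction downwards from
  \<open>n\<close>, to follow the recursion of the program.\<close>

lemma spread_eval:
  assumes "v \<le> n" "length Q \<le> M" "length X \<le> M"
  shows "eval_le prog [adj [v..<n], enc_nat v, enc_nats Q, enc_nats X] (prog ! 4)
    (enc_nats (filter (\<lambda>v. v \<in> set Q \<or> (\<exists>a\<in>set (nb v). a \<in> set Q \<and> a \<in> set X)) [v..<n]))
    ((n - v) * (member_time M + meets_time + 60) + 5)"
  using assms(1)
proof (induction v rule: inc_induct)
  case base
  have "[n..<n] = []" by simp
  then show ?case unfolding prog_nth spread_body_def Let_def
    by (simp only: filter.simps enc_list.simps)
       (rule eval_le_mono, (rule eval_le_basic)+, simp)
next
  case (step v)
  let ?P = "\<lambda>v. v \<in> set Q \<or> (\<exists>a\<in>set (nb v). a \<in> set Q \<and> a \<in> set X)"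
  have Cons: "[v..<n] = v # [Suc v..<n]" using step by (simp add: upt_conv_Cons)
  have v: "v \<le> M" using step n_le by simp
  have nv: "n - v = Suc (n - Suc v)" using step by simp
  note IH = step.IH[unfolded enc_nat.simps]
  note mem = member_eval'[OF v assms(2)] and meets = meets_eval'[OF step.hyps(2) assms(2,3)]
  consider "v \<in> set Q" | "v \<notin> set Q" "\<exists>a\<in>set (nb v). a \<in> set Q \<and> a \<in> set X"
    | "v \<notin> set Q" "\<not> (\<exists>a\<in>set (nb v). a \<in> set Q \<and> a \<in> set X)" by blast
  then show ?case
  proof cases
    case 1
    then have eq: "filter ?P [v..<n] = v # filter ?P [Suc v..<n]" by (simp add: Cons)
    show ?thesis unfolding eq nv unfolding Cons enc_list.simps prog_nth spread_body_def Let_def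
      by (rule eval_le_mono, rule eval_le_basic, rule eval_le_If_true,
          (rule eval_le_basic prog_length mem)+, rule 1,
          (rule eval_le_basic prog_length IH)+, simp)
  next
    case 2
    then have eq: "filter ?P [v..<n] = v # filter ?P [Suc v..<n]" by (simp add: Cons)
    show ?thesis unfolding eq nv unfolding Cons enc_list.simps prog_nth spread_body_def Let_def
      by (rule eval_le_mono, rule eval_le_basic, rule eval_le_If_false,
          (rule eval_le_basic prog_length mem)+, rule 2, rule eval_le_If_true,
          (rule eval_le_basic prog_length meets)+, rule 2,
          (rule eval_le_basic prog_length IH)+, simp)
  next
    case 3
    then have eq: "filter ?P [v..<n] = filter ?P [Suc v..<n]" by (simp add: Cons)
    show ?thesis unfolding eq nv unfolding Cons enc_list.simps prog_nth spread_body_def Let_def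
      by (rule eval_le_mono, rule eval_le_basic, rule eval_le_If_false,
          (rule eval_le_basic prog_length mem)+, rule 3, rule eval_le_If_false,
          (rule eval_le_basic prog_length meets)+, rule 3,
          (rule eval_le_basic prog_length IH)+, simp)
  qed
qed

lemma spread_eval':
  assumes "length Q \<le> M" "length X \<le> M"
  shows "eval_le prog [adj [0..<n], Null, enc_nats Q, enc_nats X] (prog ! 4)
    (enc_nats (spread_list X Q)) spread_time"
  unfolding spread_list_def
  by (rule eval_le_mono, rule spread_eval[of 0, unfolded enc_nat.simps])
    (use assms n_le in \<open>unfold spread_time_def, auto intro: add_right_mono mult_right_mono\<close>)

lemma length_spread_list: "length (spread_list X Q) \<le> M"
  unfolding spread_list_def using n_le by (intro order_trans[OF length_filter_le]) simp

lemma length_iterate: "length Q \<le> M \<Longrightarrow> length ((spread_list X ^^ k) Q) \<le> M"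
  by (cases k) (auto simp: length_spread_list)

lemma iterate_eval:
  assumes "length Q \<le> M" "length X \<le> M"
  shows "eval_le prog [k, adj [0..<n], enc_nats Q, enc_nats X] (prog ! 5)
    (enc_nats ((spread_list X ^^ spine k) Q)) (spine k * (spread_time + 20) + 5)"
  using assms(1)
proof (induction k arbitrary: Q)
  case Null
  show ?case unfolding prog_nth iterate_body_def spine.simps funpow.simps id_def
    by (rule eval_le_mono, (rule eval_le_basic)+, simp)
next
  case (Cell a k)
  show ?case unfolding prog_nth iterate_body_def spine.simps funpow_Suc_right o_def
    by (rule eval_le_mono,
        (rule eval_le_basic prog_length Cell.IH(2) spread_eval' length_spread_list Cell.prems assms(2))+,
        simp)
qed

definition cds_test :: "nat list \<Rightarrow> bool" where
  "cds_test X \<longleftrightarrow> X \<noteq> [] \<and> length ((spread_list X ^^ n) [hd X]) = n"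

lemma cds_eval:
  assumes "length X \<le> M"
  shows "eval_le prog [adj [0..<n], enc_nats X] (prog ! 6) (enc_bool (cds_test X)) cds_time"
proof (cases X)
  case Nil
  show ?thesis unfolding prog_nth cds_body_def Nil enc_list.simps
    by (rule eval_le_mono, (rule eval_le_basic)+, rule eval_le_false)
       (simp_all add: cds_test_def cds_time_def)
next
  case (Cons x Y)
  let ?Q = "(spread_list X ^^ n) [x]"
  have 1: "length [x] \<le> M" using n_le by simp
  have iter: "eval_le prog [adj [0..<n], adj [0..<n], Cell (enc_nat x) Null, enc_nats X] (prog ! 5)
    (enc_nats ?Q) (n * (spread_time + 20) + 5)"
    using iterate_eval[OF 1 assms, of "adj [0..<n]"] by simp
  have sl: "eval_le prog [enc_nats ?Q, adj [0..<n]] (prog ! 1) (enc_bool (cds_test X)) (10 * M + 10)"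
  proof -
    have "cds_test X \<longleftrightarrow> spine (enc_nats ?Q) = spine (adj [0..<n])"
      by (simp add: cds_test_def Cons)
    then show ?thesis
      using length_iterate[OF 1, of n X]
      by (simp only:) (rule eval_le_mono, rule same_length_eval, simp)
  qed
  have "n * (spread_time + 20) \<le> M * (spread_time + 20)" using n_le by (intro mult_right_mono) auto
  then show ?thesis
    unfolding prog_nth cds_body_def unfolding Cons enc_list.simps
    by - (rule eval_le_mono,
        (rule eval_le_basic prog_length iter[unfolded Cons enc_list.simps] sl[unfolded Cons])+,
        simp add: cds_time_def algebra_simps)
qed

fun minimal_test :: "nat list \<Rightarrow> nat list \<Rightarrow> bool" where
  "minimal_test P [] \<longleftrightarrow> True"
| "minimal_test P (x # T) \<longleftrightarrow> \<not> cds_test (P @ T) \<and> minimal_test (x # P) T"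

lemma minimal_eval:
  assumes "length P + length T \<le> M"
  shows "eval_le prog [adj [0..<n], enc_nats P, enc_nats T] (prog ! 8) (enc_bool (minimal_test P T))
    (length T * (cds_time + 20 * M + 60) + 5)"
  using assms
proof (induction T arbitrary: P)
  case Nil
  show ?case unfolding prog_nth minimal_body_def enc_list.simps
    by (rule eval_le_mono, (rule eval_le_If_Var)+, rule eval_le_true) simp_all
next
  case (Cons x T)
  have PT: "length (P @ T) \<le> M" and IHp: "length (x # P) + length T \<le> M" using Cons.prems by auto
  note IH = Cons.IH[OF IHp, unfolded enc_list.simps]
  note cds = cds_eval[OF PT]
  show ?case
  proof (cases "cds_test (P @ T)")
    case True
    show ?thesis unfolding prog_nth minimal_body_def enc_list.simps
      by (rule eval_le_mono, rule eval_le_basic, rule eval_le_If_true,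
          (rule eval_le_basic prog_length append_eval cds)+, rule True,
          rule eval_le_false, use True Cons.prems in simp_all)
  next
    case False
    then have eq: "minimal_test P (x # T) = minimal_test (x # P) T" by simp
    show ?thesis unfolding prog_nth minimal_body_def enc_list.simps eq
      by (rule eval_le_mono, rule eval_le_basic, rule eval_le_If_false,
          (rule eval_le_basic prog_length append_eval cds)+, rule False,
          (rule eval_le_basic prog_length IH)+, use Cons.prems in simp)
  qed
qed

text \<open>Only the branch without \<open>x\<close> is tested. The branch with \<open>x\<close>
  keeps the union of chosen and undecided vertices, which is an extension by the invariant.\<close>

fun enum :: "nat list \<Rightarrow> nat list \<Rightarrow> nat list \<Rightarrow> nat list list" where
  "enum I S [] = (if minimal_test I S then [S] else [])"
| "enum I S (x # r) = (if cds_test (I @ S @ r) then enum I S r else []) @ enum I (x # S) r"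

text \<open>All leaves of the recursion tree of \<open>enum\<close> count, whether or not they pass
  the minimality test.\<close>

fun leaves :: "nat list \<Rightarrow> nat list \<Rightarrow> nat list \<Rightarrow> nat" where
  "leaves I S [] = 1"
| "leaves I S (x # r) = (if cds_test (I @ S @ r) then leaves I S r else 0) + leaves I (x # S) r"

lemma leaves_pos: "1 \<le> leaves I S r"
  by (induction I S r rule: leaves.induct) auto

definition node_time :: nat where
  "node_time = (M + 1) * (cds_time + 20 * M + 60) + 60 * M + 100"

text \<open>Every node lies on a path from the root to a leaf, and such a path has
  \<open>length r + 1\<close> nodes; \<open>node_time\<close> is charged per node.\<close>

lemma enum_eval:
  assumes "length I + length S + length r \<le> M"
  shows "eval_le prog [adj [0..<n], enc_nats I, enc_nats S, enc_nats r, enc_list enc_nats acc] (prog ! 9)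
    (enc_list enc_nats (enum I S r @ acc)) (node_time * (leaves I S r * (length r + 1)))"
  using assms
proof (induction r arbitrary: S acc)
  case Nil
  have IS: "length I + length S \<le> M" using Nil by simp
  note min = minimal_eval[OF IS]
  have t: "length S * (cds_time + 20 * M + 60) \<le> M * (cds_time + 20 * M + 60)"
    using IS by (intro mult_right_mono) auto
  have node: "length S * (cds_time + 20 * M + 60) + 60 * M + 100 \<le> node_time"
    using t unfolding node_time_def distrib_right[of M 1] by linarith
  show ?case
  proof (cases "minimal_test I S")
    case True
    then have eq: "enum I S [] @ acc = S # acc" by simp
    show ?thesis unfolding eq unfolding prog_nth enum_body_def Let_def enc_list.simps
      by (rule eval_le_mono, rule eval_le_basic, rule eval_le_If_true,
          (rule eval_le_basic prog_length min)+, rule True,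
          (rule eval_le_basic)+, use node in simp)
  next
    case False
    then have eq: "enum I S [] @ acc = acc" by simp
    show ?thesis unfolding eq unfolding prog_nth enum_body_def Let_def enc_list.simps
      by (rule eval_le_mono, rule eval_le_basic, rule eval_le_If_false,
          (rule eval_le_basic prog_length min)+, rule False,
          (rule eval_le_basic)+, use node in simp)
  qed
next
  case (Cons x r)
  have len: "length (I @ S @ r) \<le> M" "length I \<le> M" "length S \<le> M"
    and IH1: "length I + length S + length r \<le> M"
    and IH2: "length I + length (x # S) + length r \<le> M" using Cons.prems by auto
  note cds = cds_eval[OF len(1)]
  define k where "k = length r + 1"
  define a b where "a = leaves I S r" and "b = leaves I (x # S) r"
  have k: "length (x # r) + 1 = k + 1" by (simp add: k_def)
  note out = Cons.IH[OF IH1, folded k_def a_def]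
    and inn = Cons.IH[OF IH2, unfolded enc_list.simps, folded k_def b_def]
  have ab: "1 \<le> a" "1 \<le> b" unfolding a_def b_def by (rule leaves_pos)+
  have node: "cds_time + 40 * M + 60 \<le> node_time" by (simp add: node_time_def)
  show ?case
  proof (cases "cds_test (I @ S @ r)")
    case True
    then have eq: "enum I S (x # r) @ acc = enum I S r @ (enum I (x # S) r @ acc)"
      and leaves: "leaves I S (x # r) = a + b" by (simp_all add: a_def b_def)
    \<comment> \<open>Raising \<open>k\<close> to \<open>k + 1\<close> frees
      \<open>a + b \<ge> 1\<close> units of \<open>node_time\<close>, which pay for the present
      node.\<close>
    have "node_time * (a * k) + node_time * (b * k) + node_time
        \<le> node_time * ((a + b) * (k + 1))"
      using ab mult_le_mono2[of 1 "a + b" node_time] by (simp add: algebra_simps)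
    then show ?thesis unfolding eq leaves k unfolding prog_nth enum_body_def Let_def enc_list.simps
      by - (rule eval_le_mono, rule eval_le_basic, rule eval_le_If_true,
          (rule eval_le_basic prog_length append_eval cds)+, rule True,
          (rule eval_le_basic prog_length out inn)+,
          use IH1 node in linarith)
  next
    case False
    then have eq: "enum I S (x # r) @ acc = enum I (x # S) r @ acc"
      and leaves: "leaves I S (x # r) = b" by (simp_all add: b_def)
    have "node_time * (b * k) + node_time \<le> node_time * (b * (k + 1))"
      using ab mult_le_mono2[of 1 b node_time] by (simp add: algebra_simps)
    then show ?thesis unfolding eq leaves k unfolding prog_nth enum_body_def Let_def enc_list.simps
      by - (rule eval_le_mono, rule eval_le_basic, rule eval_le_If_false,
          (rule eval_le_basic prog_length append_eval cds)+, rule False,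
          (rule eval_le_basic prog_length inn)+,
          use IH1 node in linarith)
  qed
qed

definition solve :: "nat list \<Rightarrow> nat list \<Rightarrow> nat list list" where
  "solve I L = (if cds_test I then [[]] else if cds_test (I @ L) then enum I [] (rev L) else [])"

definition solve_leaves :: "nat list \<Rightarrow> nat list \<Rightarrow> nat" where
  "solve_leaves I L = (if \<not> cds_test I \<and> cds_test (I @ L) then leaves I [] (rev L) else 1)"

lemma main_eval:
  assumes "length I + length L \<le> M"
  shows "eval_le prog
    [Cell x1 (Cell (adj [0..<n]) (Cell (enc_nats L) (Cell x2 (Cell x3 (Cell (enc_nats I) x4)))))]
    (prog ! 0) (enc_list enc_nats (solve I L))
    (node_time * (solve_leaves I L * (length L + 1)) + 2 * node_time)"
proof -
  have len: "length I \<le> M" "length (I @ L) \<le> M" "length L \<le> M"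
    and len': "length I + length [] + length (rev L) \<le> M" using assms by auto
  have node: "cds_time + 60 * M + 100 \<le> node_time" by (simp add: node_time_def)
  note cds = cds_eval[OF len(1)] cds_eval[OF len(2)]
  consider "cds_test I" | "\<not> cds_test I" "\<not> cds_test (I @ L)" | "\<not> cds_test I" "cds_test (I @ L)"
    by blast
  then show ?thesis
  proof cases
    case 1
    then have eq: "solve I L = [[]]" by (simp add: solve_def)
    show ?thesis unfolding eq unfolding prog_nth main_body_def Let_def enc_list.simps
      by (rule eval_le_mono, rule eval_le_If_true, (rule eval_le_basic prog_length cds)+, rule 1,
          (rule eval_le_basic)+, use node in simp)
  next
    case 2
    then have eq: "solve I L = []" by (simp add: solve_def)
    show ?thesis unfolding eq unfolding prog_nth main_body_def Let_def enc_list.simps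
      by (rule eval_le_mono, rule eval_le_If_false, (rule eval_le_basic prog_length cds(1))+, rule 2(1),
          rule eval_le_If_false, (rule eval_le_basic prog_length append_eval cds(2))+, rule 2(2),
          (rule eval_le_basic)+, use node len in simp)
  next
    case 3
    then have eq: "solve I L = enum I [] (rev L)" and lv: "solve_leaves I L = leaves I [] (rev L)"
      by (simp_all add: solve_def solve_leaves_def)
    have en: "eval_le prog [adj [0..<n], enc_nats I, Null, enc_nats (rev L), Null] (prog ! 9)
        (enc_list enc_nats (enum I [] (rev L))) (node_time * (solve_leaves I L * (length L + 1)))"
      using enum_eval[OF len', of "[]"] by (simp add: lv)
    have rv: "eval_le prog [enc_nats L, Null] (prog ! 10) (enc_nats (rev L)) (length L * 20 + 5)"
      using rev_eval[of enc_nat L "[]"] by simp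
    show ?thesis unfolding eq unfolding prog_nth main_body_def Let_def enc_list.simps
      by (rule eval_le_mono, rule eval_le_If_false, (rule eval_le_basic prog_length cds(1))+, rule 3(1),
          rule eval_le_If_true, (rule eval_le_basic prog_length append_eval cds(2))+, rule 3(2),
          (rule eval_le_basic prog_length rv en)+, use node len in simp)
  qed
qed

text \<open>Each level of nested loops, from \<open>member_time\<close> up to
  \<open>node_time\<close>, adds one to the degree.\<close>

lemma node_time_le: "node_time \<le> 1090 * M ^ 6"
proof -
  have M: "1 \<le> M" using n_le by simp
  \<comment> \<open>A loop of \<open>M\<close> rounds: as \<open>M \<ge> 1\<close>, the lower-order
    terms \<open>d\<close> and \<open>e\<close> are absorbed into the coefficient.\<close>
  have step: "M * (a + d) + e \<le> (c + d + e) * M ^ Suc k" if "a \<le> c * M ^ k" for a c d e k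
  proof -
    have one: "1 \<le> M ^ j" for j using M by simp
    have "a + d \<le> (c + d) * M ^ k"
      using that mult_le_mono2[OF one[of k], of d] unfolding distrib_right by linarith
    then have "M * (a + d) \<le> (c + d) * M ^ Suc k"
      using mult_le_mono2[of "a + d" "(c + d) * M ^ k" M] by (simp add: mult_ac)
    then show ?thesis
      using mult_le_mono2[OF one[of "Suc k"], of e] unfolding distrib_right[of "c + d" e] by linarith
  qed
  have member: "member_time M \<le> 55 * M ^ 2"
    using step[of "10 * M" 10 1 40 5] by (simp add: member_time_def numeral_2_eq_2)
  have "meets_time \<le> 155 * M ^ 3"
    using step[of "2 * member_time M" 110 2 40 5] member by (simp add: meets_time_def)
  moreover have "M ^ 2 \<le> M ^ 3" using M by (intro power_increasing) auto
  ultimately have "member_time M + meets_time \<le> 210 * M ^ 3" using member by linarith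
  then have "spread_time \<le> 275 * M ^ 4"
    using step[of "member_time M + meets_time" 210 3 60 5] by (simp add: spread_time_def)
  then have "cds_time \<le> 385 * M ^ 5"
    using step[of spread_time 275 4 50 60] by (simp add: cds_time_def algebra_simps)
  moreover have "M ^ 1 \<le> M ^ 5" "M ^ 0 \<le> M ^ 5" using M by (intro power_increasing; simp)+
  ultimately have X: "cds_time + 20 * M + 60 \<le> 465 * M ^ 5" by simp
  moreover have "M ^ 5 \<le> M ^ 6" using M by (intro power_increasing) auto
  ultimately have "cds_time + 20 * M + 60 \<le> 465 * M ^ 6" by linarith
  \<comment> \<open>Here 1090 is \<open>465 + 60 + 100\<close> from \<open>step\<close> plus 465 for
    the extra summand from the factor \<open>M + 1\<close>.\<close>
  then show ?thesis
    using step[OF X, of 60 100] by (simp add: node_time_def algebra_simps)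
qed

end

section \<open>Correctness and running time of the program\<close>

lemma enc_list_map: "enc_list f (map g xs) = enc_list (\<lambda>x. f (g x)) xs"
  by (induction xs) auto

lemma enc_list_cong: "(\<And>x. x \<in> set xs \<Longrightarrow> f x = g x) \<Longrightarrow> enc_list f xs = enc_list g xs"
  by (induction xs) auto

locale numbered_excellent_instance = excellent_instance l G L H R I O'
  for l n :: nat and G :: "nat pair_pre_digraph" and L H R I O' +
  assumes verts_eq: "pverts G = {..<n}"
begin

lemma nbrs_subset: "nbrs G v \<subseteq> {..<n}"
  using in_arcsD2 verts_eq by (auto simp: nbrs_def)

lemma finite_nbrs: "finite (nbrs G v)"
  using nbrs_subset by (rule finite_subset) simp

sublocale adjacency_lists n "\<lambda>v. sorted_list_of_set (nbrs G v)" "n + 1"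
proof
  show "length (sorted_list_of_set (nbrs G v)) \<le> n + 1" for v
    using card_mono[OF _ nbrs_subset[of v]] by simp
  show "a \<le> n + 1" if "a \<in> set (sorted_list_of_set (nbrs G v))" for a v
    using that nbrs_subset[of v] finite_nbrs[of v] by auto
qed simp

lemma adj_eq: "adj [0..<n] = enc_graph G"
  by (simp add: enc_graph_def enc_set_def[abs_def] verts_eq)

lemma set_spread_list: "set (spread_list X Q) = spread G (set X) (set Q)"
  using finite_nbrs by (auto simp: spread_list_def spread_def verts_eq)

lemma set_iterate: "set ((spread_list X ^^ k) Q) = (spread G (set X) ^^ k) (set Q)"
  by (induction k) (auto simp: set_spread_list)

text \<open>The final list is duplicate-free and within \<open>{..<n}\<close>, so its length is
  \<open>n\<close> exactly if it contains all vertices.\<close>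

lemma cds_test_iff:
  assumes "set X \<subseteq> {..<n}"
  shows "cds_test X \<longleftrightarrow> connected_dominating_set G (set X)"
proof (cases X)
  case Nil
  then show ?thesis by (simp add: cds_test_def cds_iff[OF G])
next
  case (Cons x Y)
  let ?Q = "(spread_list X ^^ n) [x]"
  \<comment> \<open>At least one round takes place, so the result is an output of
    \<open>spread_list\<close> and not the start list.\<close>
  obtain m where n: "n = Suc m" using assms Cons by (cases n) auto
  have Q: "?Q = spread_list X ((spread_list X ^^ m) [x])" by (simp add: n)
  have "distinct ?Q" and sub: "set ?Q \<subseteq> {..<n}"
    unfolding Q by (auto simp: spread_list_def)
  from \<open>distinct ?Q\<close> have "length ?Q = n \<longleftrightarrow> card (set ?Q) = n"
    by (metis distinct_card)
  also have "\<dots> \<longleftrightarrow> set ?Q = {..<n}"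
    using card_subset_eq[OF finite_lessThan sub] by (metis card_lessThan)
  also have "\<dots> \<longleftrightarrow> connected_dominating_set G (set X)"
    using cds_iff_spread[OF G, of "set X" x] assms Cons by (simp add: set_iterate verts_eq)
  finally show ?thesis by (simp add: cds_test_def Cons)
qed

text \<open>Moving \<open>x\<close> from \<open>T\<close> to \<open>P\<close> preserves the union.
  Distinctness ensures that dropping \<open>x\<close> from the list removes it from the set.\<close>

lemma minimal_test_iff:
  assumes "set P \<union> set T \<subseteq> {..<n}" "distinct (P @ T)"
  shows "minimal_test P T \<longleftrightarrow> (\<forall>x\<in>set T. \<not> connected_dominating_set G (set P \<union> set T - {x}))"
  using assms
proof (induction T arbitrary: P)
  case (Cons x T)
  have "minimal_test (x # P) T \<longleftrightarrow>
      (\<forall>y\<in>set T. \<not> connected_dominating_set G (set (x # P) \<union> set T - {y}))"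
    using Cons.prems by (intro Cons.IH) auto
  moreover have "set (x # P) \<union> set T = set P \<union> set (x # T)" by auto
  moreover have "set P \<union> set (x # T) - {x} = set (P @ T)" using Cons.prems by auto
  moreover have "cds_test (P @ T) \<longleftrightarrow> connected_dominating_set G (set (P @ T))"
    using Cons.prems by (intro cds_test_iff) auto
  ultimately show ?case by simp
qed simp

abbreviation Is :: "nat list" where
  "Is \<equiv> sorted_list_of_set I"

lemma L_lt: "L \<subseteq> {..<n}" and I_lt: "I \<subseteq> {..<n}" and finite_I: "finite I" and I_L: "I \<inter> L = {}"
proof -
  show "L \<subseteq> {..<n}" "I \<subseteq> {..<n}" "I \<inter> L = {}" using verts verts_eq by auto
  then show "finite I" using finite_subset by blast
qed

lemma set_Is: "set Is = I" using finite_I by simp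

lemma cds_test_extension:
  "set S \<subseteq> L \<Longrightarrow> cds_test (Is @ S) \<longleftrightarrow> extension G I O' (set S)"
  using L_lt I_lt by (subst cds_test_iff) (auto simp: set_Is extension_iff)

lemma minimal_test_minimal_extension:
  assumes "set S \<subseteq> L" "distinct S" "extension G I O' (set S)"
  shows "minimal_test Is S \<longleftrightarrow> minimal_extension G I O' (set S)"
proof -
  have "minimal_test Is S \<longleftrightarrow> (\<forall>x\<in>set S. \<not> connected_dominating_set G (I \<union> set S - {x}))"
    using assms L_lt I_lt I_L by (subst minimal_test_iff) (auto simp: set_Is)
  moreover have "connected_dominating_set G (I \<union> set S - {x}) \<longleftrightarrow> extension G I O' (set S - {x})"
    if "x \<in> set S" for x
  proof -
    have "I \<union> set S - {x} = I \<union> (set S - {x})" using that assms(1) I_L by auto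
    then show ?thesis using assms(1) by (auto simp: extension_iff)
  qed
  ultimately show ?thesis using assms(3) by (simp add: minimal_extension_iff)
qed

section \<open>The branching tree\<close>

text \<open>The sets still attainable once \<open>S\<close> is chosen and \<open>r\<close> is
  undecided: an interval of the subset lattice.\<close>

definition between :: "nat list \<Rightarrow> nat list \<Rightarrow> nat set \<Rightarrow> bool" where
  "between S r X \<longleftrightarrow> set S \<subseteq> X \<and> X \<subseteq> set S \<union> set r"

lemma between_Cons:
  assumes "x \<notin> set S" "x \<notin> set r"
  shows "between S (x # r) X \<longleftrightarrow> between S r X \<or> between (x # S) r X"
    and "\<not> (between S r X \<and> between (x # S) r X)"
  using assms by (auto simp: between_def)

text \<open>Justifies the pruning: if the top of the interval is no extension, no set in the
  interval is one.\<close>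

lemma extension_between:
  assumes "extension G I O' X" "between S r X" "set S \<union> set r \<subseteq> L"
  shows "extension G I O' (set S \<union> set r)"
  using assms extension_superset by (auto simp: between_def)

text \<open>The third assumption is the invariant that the top of the interval is an extension. The
  two branches cover disjoint intervals, hence no repetition. The undecided vertices are decreasing
  and below all chosen ones, so putting \<open>x\<close> in front keeps the chosen list
  sorted.\<close>

lemma enum_correct:
  assumes "sorted_wrt (<) (rev r @ S)" "set S \<union> set r \<subseteq> L" "extension G I O' (set S \<union> set r)"
  shows "distinct (map set (enum Is S r)) \<and>
    set (map set (enum Is S r)) = {X. minimal_extension G I O' X \<and> between S r X} \<and>
    (\<forall>xs\<in>set (enum Is S r). sorted_wrt (<) xs)"
  using assms
proof (induction r arbitrary: S)
  case Nil
  then have "minimal_test Is S \<longleftrightarrow> minimal_extension G I O' (set S)"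
    by (intro minimal_test_minimal_extension) (auto simp: strict_sorted_iff)
  moreover have "between S [] X \<longleftrightarrow> X = set S" for X by (auto simp: between_def)
  ultimately show ?case using Nil.prems by auto
next
  case (Cons x r)
  have x: "x \<notin> set S" "x \<notin> set r" and sorted: "sorted_wrt (<) (rev r @ S)"
    using Cons.prems(1) by (auto simp: sorted_wrt_append)
  have inn: "distinct (map set (enum Is (x # S) r)) \<and>
    set (map set (enum Is (x # S) r)) = {X. minimal_extension G I O' X \<and> between (x # S) r X} \<and>
    (\<forall>xs\<in>set (enum Is (x # S) r). sorted_wrt (<) xs)"
    using Cons.prems by (intro Cons.IH) auto
  have test: "cds_test (Is @ S @ r) \<longleftrightarrow> extension G I O' (set S \<union> set r)"
    using cds_test_extension[of "S @ r"] Cons.prems by simp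
  show ?case
  proof (cases "extension G I O' (set S \<union> set r)")
    case True
    have out: "distinct (map set (enum Is S r)) \<and>
      set (map set (enum Is S r)) = {X. minimal_extension G I O' X \<and> between S r X} \<and>
      (\<forall>xs\<in>set (enum Is S r). sorted_wrt (<) xs)"
      using Cons.prems True sorted by (intro Cons.IH) auto
    have "set (map set (enum Is S r)) \<inter> set (map set (enum Is (x # S) r)) = {}"
      using inn out between_Cons(2)[OF x] by auto
    moreover have "enum Is S (x # r) = enum Is S r @ enum Is (x # S) r" using True test by simp
    ultimately show ?thesis using inn out between_Cons(1)[OF x] by auto
  next
    case False
    then have "\<not> (extension G I O' X \<and> between S r X)" for X
      using extension_between Cons.prems(2) by auto
    then have "{X. minimal_extension G I O' X \<and> between S (x # r) X} =
        {X. minimal_extension G I O' X \<and> between (x # S) r X}"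
      using between_Cons(1)[OF x] by (auto simp: minimal_extension_def)
    then show ?thesis using inn False test by simp
  qed
qed

lemma finite_extensions: "finite {X. extension G I O' X \<and> P X}"
  by (rule finite_subset[of _ "Pow L"]) (auto simp: extension_iff finite_L)

text \<open>By the invariant each leaf is itself an extension, and different leaves give different
  sets because the intervals of the branches are disjoint.\<close>

lemma leaves_le:
  assumes "distinct (r @ S)" "set S \<union> set r \<subseteq> L" "extension G I O' (set S \<union> set r)"
  shows "leaves Is S r \<le> card {X. extension G I O' X \<and> between S r X}"
  using assms
proof (induction r arbitrary: S)
  case Nil
  then have "{X. extension G I O' X \<and> between S [] X} = {set S}" by (auto simp: between_def)
  then show ?case by simp
next
  case (Cons x r)
  have x: "x \<notin> set S" "x \<notin> set r" using Cons.prems(1) by auto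
  have inn: "leaves Is (x # S) r \<le> card {X. extension G I O' X \<and> between (x # S) r X}"
    using Cons.prems by (intro Cons.IH) auto
  have test: "cds_test (Is @ S @ r) \<longleftrightarrow> extension G I O' (set S \<union> set r)"
    using cds_test_extension[of "S @ r"] Cons.prems by simp
  have out: "(if cds_test (Is @ S @ r) then leaves Is S r else 0)
      \<le> card {X. extension G I O' X \<and> between S r X}"
    using Cons.prems test Cons.IH[of S] by auto
  have "{X. extension G I O' X \<and> between S (x # r) X} =
      {X. extension G I O' X \<and> between S r X} \<union> {X. extension G I O' X \<and> between (x # S) r X}"
    using between_Cons(1)[OF x] by auto
  moreover have "card ({X. extension G I O' X \<and> between S r X} \<union> {X. extension G I O' X \<and> between (x # S) r X})
      = card {X. extension G I O' X \<and> between S r X} + card {X. extension G I O' X \<and> between (x # S) r X}"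
    using between_Cons(2)[OF x] by (intro card_Un_disjoint finite_extensions) auto
  ultimately show ?case using inn out by simp
qed

abbreviation Ls :: "nat list" where
  "Ls \<equiv> sorted_list_of_set L"

lemma set_Ls: "set Ls = L" using finite_L by simp

lemma cds_test_empty: "cds_test Is \<longleftrightarrow> extension G I O' {}"
  using cds_test_extension[of "[]"] by simp

lemma cds_test_all: "cds_test (Is @ Ls) \<longleftrightarrow> extension G I O' L"
  using cds_test_extension[of Ls] by (simp add: set_Ls)

lemma solve_correct:
  "distinct (map set (solve Is Ls)) \<and> set (map set (solve Is Ls)) = {X. minimal_extension G I O' X} \<and>
    (\<forall>xs\<in>set (solve Is Ls). sorted_wrt (<) xs)"
proof -
  consider "extension G I O' {}" | "\<not> extension G I O' {}" "\<not> extension G I O' L"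
    | "\<not> extension G I O' {}" "extension G I O' L" by blast
  then show ?thesis
  proof cases
    case 1
    then show ?thesis
      using minimal_extensions_if_empty_extension by (simp add: solve_def cds_test_empty)
  next
    case 2
    then have "\<not> minimal_extension G I O' X" for X
      using extension_superset[of X L] by (auto simp: minimal_extension_def extension_iff)
    then show ?thesis using 2 by (simp add: solve_def cds_test_empty cds_test_all)
  next
    case 3
    have "minimal_extension G I O' X \<Longrightarrow> between [] (rev Ls) X" for X
      by (auto simp: minimal_extension_def extension_iff between_def set_Ls)
    then have "{X. minimal_extension G I O' X \<and> between [] (rev Ls) X} = {X. minimal_extension G I O' X}"
      by auto
    then show ?thesis
      using enum_correct[of "rev Ls" "[]"] 3 by (simp add: solve_def cds_test_empty cds_test_all set_Ls)
  qed
qed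

text \<open>Branching happens only when the empty set is not an extension, which is what
  \<open>card_extensions_le\<close> requires.\<close>

lemma solve_leaves_le: "real (solve_leaves Is Ls) \<le> bound"
proof (cases "\<not> cds_test Is \<and> cds_test (Is @ Ls)")
  case True
  then have ext: "\<not> extension G I O' {}" "extension G I O' L"
    by (simp_all add: cds_test_empty cds_test_all)
  have "leaves Is [] (rev Ls) \<le> card {X. extension G I O' X \<and> between [] (rev Ls) X}"
    using ext by (intro leaves_le) (auto simp: set_Ls)
  also have "\<dots> \<le> card {X. extension G I O' X}"
    using finite_extensions[of "\<lambda>_. True"] by (intro card_mono) auto
  finally show ?thesis
    using card_extensions_le[OF ext(1)] True by (simp add: solve_leaves_def)
next
  case False
  then have "solve_leaves Is Ls = 1" by (auto simp: solve_leaves_def)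
  then show ?thesis using bound_ge_1 by simp
qed

lemma card_I_L: "card I + card L \<le> n"
proof -
  have "card I + card L = card (I \<union> L)"
    using finite_I finite_L I_L by (simp add: card_Un_disjoint)
  also have "\<dots> \<le> n" using I_lt L_lt card_mono[of "{..<n}" "I \<union> L"] by simp
  finally show ?thesis .
qed

lemma prog_runs:
  "\<exists>Ss t. runs prog (enc_input l G L H R I O') (enc_list enc_set Ss) t \<and>
     distinct Ss \<and> set Ss = {S. minimal_extension G I O' S} \<and>
     real t \<le> 3270 * bound * (real n + 1) ^ 7"
proof -
  let ?Ss = "map set (solve Is Ls)"
  have enc: "enc_list enc_set ?Ss = enc_list enc_nats (solve Is Ls)"
    unfolding enc_list_map
  proof (rule enc_list_cong)
    fix xs assume "xs \<in> set (solve Is Ls)"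
    \<comment> \<open>Sorted duplicate-free lists are the canonical ones used by
      \<open>enc_set\<close>, so the output needs no conversion.\<close>
    then have "sorted xs" "distinct xs" using solve_correct by (auto simp: strict_sorted_iff)
    then show "enc_set (set xs) = enc_nats xs"
      by (simp add: enc_set_def sorted_list_of_set.idem_if_sorted_distinct)
  qed
  have len: "length Is + length Ls \<le> n + 1" using card_I_L by simp
  obtain t where t: "t \<le> node_time * (solve_leaves Is Ls * (length Ls + 1)) + 2 * node_time"
    and run: "eval prog [enc_input l G L H R I O'] (prog ! 0) (enc_list enc_set ?Ss) t"
    using main_eval[OF len, of "enc_nat l" "enc_set H" "enc_set R" "enc_set O'"]
    unfolding eval_le_def enc enc_input_def adj_eq enc_set_def[of L] enc_set_def[of I] by blast
  have node: "real node_time \<le> 1090 * (real n + 1) ^ 6"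
  proof -
    have "real node_time \<le> real (1090 * (n + 1) ^ 6)" using node_time_le by (simp only: of_nat_le_iff)
    then show ?thesis by (simp add: add.commute)
  qed
  have "real (card L) + 1 \<le> real n + 1" using card_I_L by simp
  then have "real (solve_leaves Is Ls) * (real (card L) + 1) \<le> bound * (real n + 1)"
    using solve_leaves_le bound_ge_1 by (intro mult_mono) auto
  \<comment> \<open>Absorbs the additive \<open>2 * node_time\<close>; together with the leaf term
    this makes the factor 3 in \<open>3270 = 3 * 1090\<close>.\<close>
  moreover have "2 \<le> 2 * (bound * (real n + 1))"
    using mult_mono[OF bound_ge_1, of 1 "real n + 1"] bound_ge_1 by simp
  ultimately have sum: "real (solve_leaves Is Ls) * (real (card L) + 1) + 2 \<le> 3 * (bound * (real n + 1))"
    by linarith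
  have "real t \<le> real (node_time * (solve_leaves Is Ls * (length Ls + 1)) + 2 * node_time)"
    using t by (simp only: of_nat_le_iff)
  also have "\<dots> = real node_time * (real (solve_leaves Is Ls) * (real (card L) + 1) + 2)"
    by (simp add: algebra_simps)
  also have "\<dots> \<le> 1090 * (real n + 1) ^ 6 * (3 * (bound * (real n + 1)))"
    using node sum by (intro mult_mono) auto
  also have "\<dots> = 3270 * bound * (real n + 1) ^ 7"
    by (simp add: power_Suc eval_nat_numeral mult_ac)
  finally have time: "real t \<le> 3270 * bound * (real n + 1) ^ 7" .
  have "runs prog (enc_input l G L H R I O') (enc_list enc_set ?Ss) t"
    using run by (simp add: runs_def prog_def)
  with time solve_correct show ?thesis by blast
qed

end

text \<open>The program and both constants are fixed before \<open>l\<close>, so the polynomial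
  factor is uniform in \<open>l\<close>. The enumeration is over vertices \<open>{..<n}\<close>
  because the input has to be encoded, while the counting bound holds for any vertex type.\<close>

theorem lemma16:
  shows "(\<forall>(l::nat) (G::'a pair_pre_digraph) L H R I O'.
            l \<ge> 1 \<and> pair_graph G \<and> excellent_partition l G L H R \<and> partition2 (H \<union> R) I O' \<and>
            real (card {v \<in> R. out_degree (with_proj G) v < 10 * l}) \<ge> real (card L) / 10 \<longrightarrow>
            real (card {S. minimal_extension G I O' S})
              \<le> 2 ^ card L * exp (- (real (card L) / (2 ^ (10 * l) * 100 * (real l)\<^sup>2))))
       \<and> (\<exists>(p::program) (C::real) (c::nat).
            \<forall>(l::nat) (n::nat) (G::nat pair_pre_digraph) L H R I O'.
              l \<ge> 1 \<and> pair_graph G \<and> pverts G = {..<n} \<and>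
              excellent_partition l G L H R \<and> partition2 (H \<union> R) I O' \<and>
              real (card {v \<in> R. out_degree (with_proj G) v < 10 * l}) \<ge> real (card L) / 10 \<longrightarrow>
              (\<exists>Ss t. runs p (enc_input l G L H R I O') (enc_list enc_set Ss) t \<and>
                 distinct Ss \<and> set Ss = {S. minimal_extension G I O' S} \<and>
                 real t \<le> C * (2 ^ card L * exp (- (real (card L) / (2 ^ (10 * l) * 100 * (real l)\<^sup>2))))
                            * (real n + 1) ^ c))"
proof (intro conjI)
  show "\<forall>(l::nat) (G::'a pair_pre_digraph) L H R I O'.
            l \<ge> 1 \<and> pair_graph G \<and> excellent_partition l G L H R \<and> partition2 (H \<union> R) I O' \<and>
            real (card {v \<in> R. out_degree (with_proj G) v < 10 * l}) \<ge> real (card L) / 10 \<longrightarrow>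
            real (card {S. minimal_extension G I O' S})
              \<le> 2 ^ card L * exp (- (real (card L) / (2 ^ (10 * l) * 100 * (real l)\<^sup>2)))"
    by (blast intro: excellent_instance.card_minimal_extensions_le excellent_instance.intro)
next
  show "\<exists>(p::program) (C::real) (c::nat).
            \<forall>(l::nat) (n::nat) (G::nat pair_pre_digraph) L H R I O'.
              l \<ge> 1 \<and> pair_graph G \<and> pverts G = {..<n} \<and>
              excellent_partition l G L H R \<and> partition2 (H \<union> R) I O' \<and>
              real (card {v \<in> R. out_degree (with_proj G) v < 10 * l}) \<ge> real (card L) / 10 \<longrightarrow>
              (\<exists>Ss t. runs p (enc_input l G L H R I O') (enc_list enc_set Ss) t \<and>
                 distinct Ss \<and> set Ss = {S. minimal_extension G I O' S} \<and>
                 real t \<le> C * (2 ^ card L * exp (- (real (card L) / (2 ^ (10 * l) * 100 * (real l)\<^sup>2))))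
                            * (real n + 1) ^ c)"
    by (rule exI[of _ prog], rule exI[of _ 3270], rule exI[of _ 7],
        intro allI impI numbered_excellent_instance.prog_runs numbered_excellent_instance.intro
          excellent_instance.intro numbered_excellent_instance_axioms.intro) blast+
qed

end
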